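(* Let $I\subseteq\mathbb{R}$ be an interval, $(X,\mathbf{d})$ a metric space, $\gamma:I\to X$ locally of bounded variation, $\nu$ the speed measure of $\gamma$, and $\nu=\nu_{\mathrm{ac}}+\nu_{\mathrm{sing}}$ its Lebesgue decomposition with respect to Lebesgue measure $\lambda$ on $I$ (with $\nu_{\mathrm{ac}}$ absolutely continuous and $\nu_{\mathrm{sing}}$ singular with respect to $\lambda$). Then the metric derivative $|\dot\gamma|(t)$ exists for $\lambda$-almost all $t\in I$, $\nu_{\mathrm{ac}}=|\dot\gamma|\cdot\lambda$ (i.e. $|\dot\gamma|$ is the Radon–Nikodým density of $\nu_{\mathrm{ac}}$ with respect to $\lambda$), and for all intervals $J\subseteq I$ one has $$\operatorname{Var}(\gamma;J)\le\int_J|\dot\gamma|\,\mathrm{d}\lambda+\nu_{\mathrm{sing}}(J),$$ with equality if $J\setminus\mathring{J}\subseteq I\setminus\mathsf{D}(\gamma)$. In particular, if $\gamma$ is a curve (i.e. continuous), one has for all intervals $J\subseteq I$ $$\mathsf{L}(\gamma|_J)=\int_J|\dot\gamma|\,\mathrm{d}\lambda+\nu_{\mathrm{sing}}(J).$$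
   Context: An interval is a connected subset of $\mathbb{R}$; $\mathring{J}$ denotes the interior of $J$ in $\mathbb{R}$. For $\gamma:I\to X$ and a subinterval $J\subseteq I$, $\operatorname{Var}(\gamma;J)\in[0,\infty]$ is the supremum of $\sum_{k=1}^n\mathbf{d}(\gamma(t_k),\gamma(t_{k+1}))$ over all $n\in\mathbb{N}$ and all $t_1\le t_2\le\dots\le t_{n+1}$ in $J$ (the supremum of the empty set being $0$). For continuous $\gamma$, $\mathsf{L}(\gamma|_J):=\operatorname{Var}(\gamma;J)$ is the length of $\gamma|_J$. $\gamma$ is locally of bounded variation if $\operatorname{Var}(\gamma;[a,b])<\infty$ for all $a\le b$ in $I$. $\mathsf{D}(\gamma)$ is the set of $t\in I$ at which $\gamma$ is not continuous. Metric derivative at $t\in I$: $|\dot\gamma|(t):=\lim_{\varepsilon\to0}\frac{\mathbf{d}(\gamma(t+\varepsilon),\gamma(t))}{|\varepsilon|}$, provided the limit exists (the limit is over $\varepsilon\neq 0$ with $t+\varepsilon\in I$, two-sided at interior points). Speed measure of $\gamma$ locally of bounded variation: with the convention $\operatorname{Var}(\gamma;[b,a]):=-\operatorname{Var}(\gamma;[a,b])$ for $a\le b$, fix $c\in I$ and set $\operatorname{V}_\gamma(t):=\operatorname{Var}(\gamma;[c,t])$, a nondecreasing real function on $I$. Let $\operatorname{v}(t):=\operatorname{V}_\gamma(t+)$ be its right limit at $t\in I$ (with $\operatorname{V}_\gamma(b+):=\operatorname{V}_\gamma(b)$ if $b=\sup I\in I$), and let $\mu_{\operatorname{v}}$ be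 the Lebesgue–Stieltjes measure on the Borel sets of $I$, characterized by $\mu_{\operatorname{v}}((s,t])=\operatorname{v}(t)-\operatorname{v}(s)$ for $s\le t$ in $I$ (and $\mu_{\operatorname{v}}(\{a\})=0$ if $a=\inf I\in I$). If $a=\inf I\in I$, the speed measure is $\nu:=\mu_{\operatorname{v}}+(\operatorname{V}_\gamma(a+)-\operatorname{V}_\gamma(a))\delta_a$; otherwise $\nu:=\mu_{\operatorname{v}}$. It does not depend on $c$. *)

theory Defs
  imports "HOL-Analysis.Analysis"
begin

text \<open>
  A map \<open>\<gamma> : I \<rightarrow> X\<close> is represented by a total function
  \<^typ>\<open>real \<Rightarrow> 'a::metric_space\<close> together with the set \<open>I\<close>; none of the
  notions below depends on the values of \<open>\<gamma>\<close> outside \<open>I\<close>, as long as the arguments \<open>J\<close>, \<open>t\<close>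
  and \<open>c\<close> satisfy \<open>J \<subseteq> I\<close>, \<open>t \<in> I\<close> and \<open>c \<in> I\<close>.
  An interval is a set \<open>I :: real set\<close> with \<open>connected I\<close>.
\<close>

definition variation :: "(real \<Rightarrow> 'a::metric_space) \<Rightarrow> real set \<Rightarrow> ennreal" where
  "variation \<gamma> J =
     (SUP (n, t) \<in> {(n::nat, t::nat \<Rightarrow> real). mono_on {1..n+1} t \<and> t ` {1..n+1} \<subseteq> J}.
        ennreal (\<Sum>k=1..n. dist (\<gamma> (t k)) (\<gamma> (t (k+1)))))"

definition curve_length :: "(real \<Rightarrow> 'a::metric_space) \<Rightarrow> real set \<Rightarrow> ennreal" where
  "curve_length \<gamma> J = variation \<gamma> J"

definition locally_bounded_variation :: "real set \<Rightarrow> (real \<Rightarrow> 'a::metric_space) \<Rightarrow> bool" where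
  "locally_bounded_variation I \<gamma> \<longleftrightarrow>
     (\<forall>a\<in>I. \<forall>b\<in>I. a \<le> b \<longrightarrow> variation \<gamma> {a..b} < \<infinity>)"

definition discontinuities :: "real set \<Rightarrow> (real \<Rightarrow> 'a::metric_space) \<Rightarrow> real set" where
  "discontinuities I \<gamma> = {t \<in> I. \<not> continuous (at t within I) \<gamma>}"

definition has_metric_derivative ::
  "real set \<Rightarrow> (real \<Rightarrow> 'a::metric_space) \<Rightarrow> real \<Rightarrow> real \<Rightarrow> bool" where
  "has_metric_derivative I \<gamma> t m \<longleftrightarrow>
     ((\<lambda>\<epsilon>. dist (\<gamma> (t + \<epsilon>)) (\<gamma> t) / \<bar>\<epsilon>\<bar>) \<longlongrightarrow> m) (at 0 within {\<epsilon>. t + \<epsilon> \<in> I})"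

text \<open>Where the limit does not exist, the metric derivative is set to \<open>0\<close>.\<close>

definition metric_derivative :: "real set \<Rightarrow> (real \<Rightarrow> 'a::metric_space) \<Rightarrow> real \<Rightarrow> real" where
  "metric_derivative I \<gamma> t =
     (if \<exists>m. has_metric_derivative I \<gamma> t m then THE m. has_metric_derivative I \<gamma> t m else 0)"

definition variation_from ::
  "real \<Rightarrow> (real \<Rightarrow> 'a::metric_space) \<Rightarrow> real \<Rightarrow> real" where
  "variation_from c \<gamma> t =
     (if c \<le> t then enn2real (variation \<gamma> {c..t}) else - enn2real (variation \<gamma> {t..c}))"

definition right_limit_on :: "real set \<Rightarrow> (real \<Rightarrow> real) \<Rightarrow> real \<Rightarrow> real" where
  "right_limit_on I f t = (if \<forall>s\<in>I. s \<le> t then f t else Lim (at_right t) f)"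

abbreviation borel_on :: "real set \<Rightarrow> real measure" where
  "borel_on I \<equiv> restrict_space borel I"

abbreviation lborel_on :: "real set \<Rightarrow> real measure" where
  "lborel_on I \<equiv> restrict_space lborel I"

text \<open>
  The library's \<^const>\<open>interval_measure\<close> needs a distribution function on the whole
  line. A nondecreasing function on \<open>I\<close> need not extend to one (it may tend to \<open>-\<infinity>\<close> at an
  endpoint not in \<open>I\<close>), so the measure on \<open>I\<close> is introduced by its characterization.
\<close>

definition lebesgue_stieltjes_on :: "real set \<Rightarrow> (real \<Rightarrow> real) \<Rightarrow> real measure" where
  "lebesgue_stieltjes_on I v = (THE \<mu>.
     space \<mu> = I \<and> sets \<mu> = sets (borel_on I) \<and>
     (\<forall>s\<in>I. \<forall>t\<in>I. s \<le> t \<longrightarrow> emeasure \<mu> {s<..t} = ennreal (v t - v s)) \<and>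
     (\<forall>a\<in>I. (\<forall>t\<in>I. a \<le> t) \<longrightarrow> emeasure \<mu> {a} = 0))"

text \<open>
  The sum runs over the at most one \<open>a \<in> I\<close> with \<open>a = inf I\<close>, so that it is the
  atom \<open>(V(a+) - V(a)) \<delta>\<^sub>a\<close> if \<open>I\<close> has a minimum and \<open>0\<close> otherwise.
\<close>

definition speed_measure ::
  "real set \<Rightarrow> real \<Rightarrow> (real \<Rightarrow> 'a::metric_space) \<Rightarrow> real measure" where
  "speed_measure I c \<gamma> =
     (let V = variation_from c \<gamma>; v = right_limit_on I V in
      measure_of I (sets (borel_on I))
        (\<lambda>A. emeasure (lebesgue_stieltjes_on I v) A
           + (\<Sum>a | a \<in> I \<and> (\<forall>t\<in>I. a \<le> t). ennreal (v a - V a) * indicator A a)))"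

definition mutually_singular :: "'b measure \<Rightarrow> 'b measure \<Rightarrow> bool" where
  "mutually_singular M N \<longleftrightarrow>
     sets M = sets N \<and>
     (\<exists>A\<in>sets M. emeasure M A = 0 \<and> emeasure N (space M - A) = 0)"

definition lebesgue_decomposition ::
  "'b measure \<Rightarrow> 'b measure \<Rightarrow> 'b measure \<Rightarrow> 'b measure \<Rightarrow> bool" where
  "lebesgue_decomposition M N N_ac N_sing \<longleftrightarrow>
     sets N = sets M \<and> sets N_ac = sets M \<and> sets N_sing = sets M \<and>
     (\<forall>A\<in>sets M. emeasure N A = emeasure N_ac A + emeasure N_sing A) \<and>
     absolutely_continuous M N_ac \<and> mutually_singular M N_sing"

end

(* The chord length dist (gamma s) (gamma t) is at most the variation V t - V s, and V t - V s is
   squeezed between the speed measures of the open and of the closed interval. Hence it suffices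
   (1) to differentiate the speed measure, whose absolutely continuous part has a density f:
   on {f <= q} off the singular null set (resp. on {q <= f}) it is compared with q times Lebesgue
   measure, the error being a measure that vanishes on that set and hence, by outer regularity and
   the Vitali covering lemma, has density 0 at almost every point of it; and
   (2) to show that chords lose only o(|t - s|) of the variation almost everywhere. *)
theory Submission
  imports Defs
begin

section \<open>Variation\<close>

text \<open>\<open>V\<close> is not a distribution function of the speed measure: where
  \<open>\<gamma>\<close> jumps, \<open>V t - V s\<close> may count only part of the atoms at
  \<open>s\<close> and \<open>t\<close>, whereas the measure of \<open>{s<..t}\<close> counts all of
  the one at \<open>t\<close> and nothing of the one at \<open>s\<close>. Hence comparisons pass
  through open and closed intervals. Endpoints matter again only in the variation formula, where
  continuity of \<open>\<gamma>\<close> at a boundary point excludes an atom there. Both covering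
  arguments rest on one weak-type bound; they differ in the quantity that is summed over disjoint
  balls: the mass off a set in (1), the increment of a nondecreasing function in (2). The density f
  is determined only up to null sets, and the measurable sets of \<open>lborel\<close> are just the
  Borel sets. So agreement with f almost everywhere does not make the metric derivative measurable;
  a separate argument evaluates its upper and lower limits along a countable set. Each null set
  depends on a bound \<open>q\<close>, a tolerance and a window \<open>{a..b}\<close>; letting these
  run through rationals keeps the union null. The windows also cope with a speed measure that may be
  finite only on compact subintervals of \<open>I\<close>.\<close>

lemma variation_sum_le:
  assumes "mono_on {..n} w" "w ` {..n} \<subseteq> J"
  shows "ennreal (\<Sum>k<n. dist (\<gamma> (w k)) (\<gamma> (w (Suc k)))) \<le> variation \<gamma> J"
proof -
  let ?t = "\<lambda>k. w (k - 1)"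
  have "mono_on {1..n+1} ?t" "?t ` {1..n+1} \<subseteq> J"
    using assms(2) by (auto intro!: mono_onI mono_onD[OF assms(1)] simp: image_subset_iff)
  moreover have "(\<Sum>k<n. dist (\<gamma> (w k)) (\<gamma> (w (Suc k)))) = (\<Sum>k=1..n. dist (\<gamma> (?t k)) (\<gamma> (?t (k+1))))"
    by (rule sum.reindex_bij_witness[of _ "\<lambda>k. k - 1" Suc]) auto
  ultimately show ?thesis
    unfolding variation_def by (intro SUP_upper2[of "(n, ?t)"]) auto
qed

text \<open>Together with \<open>variation_sum_le\<close> this replaces the definition, whose points
  are numbered from 1: all later partitions are \<open>w 0\<close>, ..., \<open>w n\<close>, and the
  index shift is confined to these two rules.\<close>

lemma variation_leI:
  assumes "\<And>n w. mono_on {..n} w \<Longrightarrow> w ` {..n} \<subseteq> J \<Longrightarrow>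
    ennreal (\<Sum>k<n. dist (\<gamma> (w k)) (\<gamma> (w (Suc k)))) \<le> B"
  shows "variation \<gamma> J \<le> B"
  unfolding variation_def
proof (intro SUP_least, clarsimp)
  fix n :: nat and t :: "nat \<Rightarrow> real"
  assume *: "mono_on {Suc 0..Suc n} t" "t ` {Suc 0..Suc n} \<subseteq> J"
  have "(\<Sum>k=Suc 0..n. dist (\<gamma> (t k)) (\<gamma> (t (Suc k)))) = (\<Sum>k<n. dist (\<gamma> (t (Suc k))) (\<gamma> (t (Suc (Suc k)))))"
    by (rule sum.reindex_bij_witness[of _ Suc "\<lambda>k. k - 1"]) auto
  moreover have "mono_on {..n} (\<lambda>k. t (Suc k))" "(\<lambda>k. t (Suc k)) ` {..n} \<subseteq> J"
    using * by (auto simp: mono_on_def image_subset_iff)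
  ultimately show "ennreal (\<Sum>k=Suc 0..n. dist (\<gamma> (t k)) (\<gamma> (t (Suc k)))) \<le> B"
    using assms[of n "\<lambda>k. t (Suc k)"] by simp
qed

lemma variation_mono: "J \<subseteq> J' \<Longrightarrow> variation \<gamma> J \<le> variation \<gamma> J'"
  by (intro variation_leI variation_sum_le) auto

lemma dist_le_variation:
  assumes "s \<in> J" "t \<in> J" "s \<le> t"
  shows "ennreal (dist (\<gamma> s) (\<gamma> t)) \<le> variation \<gamma> J"
proof -
  let ?w = "\<lambda>k::nat. if k = 0 then s else t"
  have "mono_on {..1} ?w" "?w ` {..1} \<subseteq> J"
    using assms by (auto simp: mono_on_def)
  from variation_sum_le[OF this, of \<gamma>] show ?thesis by simp
qed

text \<open>A partition of \<open>J1\<close> followed by one of \<open>J2\<close> is a partition in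
  \<open>J\<close>; its chord sum exceeds the two given ones by the linking chord.\<close>

lemma variation_concat:
  assumes "J1 \<noteq> {}" "J2 \<noteq> {}" "J1 \<subseteq> J" "J2 \<subseteq> J" and le: "\<And>x y. x \<in> J1 \<Longrightarrow> y \<in> J2 \<Longrightarrow> x \<le> y"
  shows "variation \<gamma> J1 + variation \<gamma> J2 \<le> variation \<gamma> J"
proof -
  have *: "ennreal (\<Sum>k<n. dist (\<gamma> (w k)) (\<gamma> (w (Suc k)))) + ennreal (\<Sum>k<m. dist (\<gamma> (u k)) (\<gamma> (u (Suc k))))
     \<le> variation \<gamma> J" (is "ennreal (?A w n) + ennreal (?A u m) \<le> _")
    if w: "mono_on {..n} w" "w ` {..n} \<subseteq> J1" and u: "mono_on {..m} u" "u ` {..m} \<subseteq> J2" for n w m u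
  proof -
    \<comment> \<open>The second partition starts at index \<open>Suc n\<close>, so the chord from
      index \<open>n\<close> to \<open>Suc n\<close> is the linking one, which is dropped
      below.\<close>
    define p where "p k = (if k \<le> n then w k else u (k - Suc n))" for k
    have "mono_on {..Suc n + m} p"
    proof (rule mono_onI)
      fix r s assume "r \<in> {..Suc n + m}" "s \<in> {..Suc n + m}" "r \<le> s"
      then consider "s \<le> n" | "r \<le> n" "\<not> s \<le> n" | "\<not> r \<le> n" by linarith
      then show "p r \<le> p s"
        using w(2) u(2) \<open>r \<le> s\<close> \<open>s \<in> {..Suc n + m}\<close> mono_onD[OF w(1), of r s]
          mono_onD[OF u(1), of "r - Suc n" "s - Suc n"] le[of "w r" "u (s - Suc n)"]
        by cases (auto simp: p_def image_subset_iff)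
    qed
    moreover have "p ` {..Suc n + m} \<subseteq> J"
      using w u assms(3,4) by (auto simp: p_def image_subset_iff)
    ultimately have "ennreal (?A p (Suc n + m)) \<le> variation \<gamma> J"
      by (rule variation_sum_le)
    moreover have "?A w n + ?A u m \<le> ?A p (Suc n + m)"
    proof -
      have "?A p (Suc n + m) = ?A p (Suc n) + (\<Sum>k<m. dist (\<gamma> (p (Suc n + k))) (\<gamma> (p (Suc (Suc n + k)))))"
        by (induction m) auto
      also have "(\<Sum>k<m. dist (\<gamma> (p (Suc n + k))) (\<gamma> (p (Suc (Suc n + k))))) = ?A u m"
        by (rule sum.cong) (auto simp: p_def)
      also have "?A p (Suc n) = ?A w n + dist (\<gamma> (p n)) (\<gamma> (p (Suc n)))"
        by (simp add: p_def)
      finally show ?thesis by simp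
    qed
    ultimately have "ennreal (?A w n + ?A u m) \<le> variation \<gamma> J"
      by (meson ennreal_leI order_trans)
    then show ?thesis by (simp add: sum_nonneg)
  qed
  \<comment> \<open>The two suprema are taken one after the other. Each time the summand held fixed
    is moved to the right-hand side, which is safe in \<open>ennreal\<close> only because it is
    finite.\<close>
  have "variation \<gamma> J1 + ennreal (\<Sum>k<m. dist (\<gamma> (u k)) (\<gamma> (u (Suc k)))) \<le> variation \<gamma> J"
    if u: "mono_on {..m} u" "u ` {..m} \<subseteq> J2" for m u
  proof -
    let ?x = "ennreal (\<Sum>k<m. dist (\<gamma> (u k)) (\<gamma> (u (Suc k))))"
    have fin: "?x \<noteq> top" by simp
    have "variation \<gamma> J1 \<le> variation \<gamma> J - ?x"
    proof (rule variation_leI)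
      fix n and w :: "nat \<Rightarrow> real" assume "mono_on {..n} w" "w ` {..n} \<subseteq> J1"
      from *[OF this u] fin show "ennreal (\<Sum>k<n. dist (\<gamma> (w k)) (\<gamma> (w (Suc k)))) \<le> variation \<gamma> J - ?x"
        by (metis add.commute ennreal_add_diff_cancel_left ennreal_minus_mono order_refl)
    qed
    moreover have "?x \<le> variation \<gamma> J"
      using variation_sum_le[OF u] variation_mono[OF assms(4)] order_trans by blast
    ultimately show ?thesis
      by (metis add_mono diff_add_cancel_ennreal order_refl)
  qed
  note ** = this
  show ?thesis
  proof (cases "variation \<gamma> J1 = top")
    case True
    then show ?thesis using variation_mono[OF assms(3), of \<gamma>] by (simp add: top_unique)
  next
    case False
    have "variation \<gamma> J2 \<le> variation \<gamma> J - variation \<gamma> J1"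
    proof (rule variation_leI)
      fix n and w :: "nat \<Rightarrow> real" assume "mono_on {..n} w" "w ` {..n} \<subseteq> J2"
      from **[OF this] False show "ennreal (\<Sum>k<n. dist (\<gamma> (w k)) (\<gamma> (w (Suc k)))) \<le> variation \<gamma> J - variation \<gamma> J1"
        by (metis ennreal_add_diff_cancel_left ennreal_minus_mono order_refl)
    qed
    then show ?thesis
      by (metis add.commute add_mono assms(3) diff_add_cancel_ennreal order_refl variation_mono)
  qed
qed

text \<open>Clamping a partition to \<open>{a..b}\<close> and to \<open>{b..c}\<close> replaces the
  chord that crosses \<open>b\<close> by two chords meeting at \<open>b\<close>, so the triangle
  inequality gives one direction; \<open>variation_concat\<close> gives the other.\<close>

lemma variation_add:
  assumes "a \<le> b" "b \<le> c"
  shows "variation \<gamma> {a..c} = variation \<gamma> {a..b} + variation \<gamma> {b..c}"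
proof (rule antisym)
  show "variation \<gamma> {a..c} \<le> variation \<gamma> {a..b} + variation \<gamma> {b..c}"
  proof (rule variation_leI)
    fix n and w :: "nat \<Rightarrow> real" assume w: "mono_on {..n} w" "w ` {..n} \<subseteq> {a..c}"
    let ?u = "\<lambda>k. min (w k) b" and ?v = "\<lambda>k. max (w k) b"
    have "mono_on {..n} ?u" "?u ` {..n} \<subseteq> {a..b}" "mono_on {..n} ?v" "?v ` {..n} \<subseteq> {b..c}"
      using w assms by (fastforce simp: mono_on_def image_subset_iff min_def max_def)+
    then have "ennreal (\<Sum>k<n. dist (\<gamma> (?u k)) (\<gamma> (?u (Suc k)))) + ennreal (\<Sum>k<n. dist (\<gamma> (?v k)) (\<gamma> (?v (Suc k))))
       \<le> variation \<gamma> {a..b} + variation \<gamma> {b..c}"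
      by (intro add_mono variation_sum_le) auto
    moreover have "dist (\<gamma> (w k)) (\<gamma> (w (Suc k))) \<le> dist (\<gamma> (?u k)) (\<gamma> (?u (Suc k))) + dist (\<gamma> (?v k)) (\<gamma> (?v (Suc k)))"
      if "k < n" for k
    proof -
      have "w k \<le> w (Suc k)" using w(1) that by (auto simp: mono_on_def)
      then show ?thesis
        by (auto simp: min_def max_def dist_triangle)
    qed
    then have "(\<Sum>k<n. dist (\<gamma> (w k)) (\<gamma> (w (Suc k))))
       \<le> (\<Sum>k<n. dist (\<gamma> (?u k)) (\<gamma> (?u (Suc k)))) + (\<Sum>k<n. dist (\<gamma> (?v k)) (\<gamma> (?v (Suc k))))"
      unfolding sum.distrib[symmetric] by (intro sum_mono) auto
    then have "ennreal (\<Sum>k<n. dist (\<gamma> (w k)) (\<gamma> (w (Suc k))))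
       \<le> ennreal (\<Sum>k<n. dist (\<gamma> (?u k)) (\<gamma> (?u (Suc k)))) + ennreal (\<Sum>k<n. dist (\<gamma> (?v k)) (\<gamma> (?v (Suc k))))"
      by (metis (no_types, lifting) ennreal_leI ennreal_plus sum_nonneg zero_le_dist)
    ultimately show "ennreal (\<Sum>k<n. dist (\<gamma> (w k)) (\<gamma> (w (Suc k)))) \<le> variation \<gamma> {a..b} + variation \<gamma> {b..c}"
      by order
  qed
  show "variation \<gamma> {a..b} + variation \<gamma> {b..c} \<le> variation \<gamma> {a..c}"
    using assms by (intro variation_concat) auto
qed

text \<open>Adjoining \<open>a\<close> and \<open>b\<close> to a partition cannot decrease its chord
  sum. The fixed endpoints let increments of another function along \<open>w\<close> telescope over
  the whole of \<open>{a..b}\<close>.\<close>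

lemma variation_approx:
  assumes "a \<le> b" "B < variation \<gamma> {a..b}"
  obtains n w where "mono_on {..n} w" "w 0 = a" "w n = b"
    "B < ennreal (\<Sum>k<n. dist (\<gamma> (w k)) (\<gamma> (w (Suc k))))"
proof -
  have "\<not> variation \<gamma> {a..b} \<le> B" using assms by simp
  then obtain n u where u: "mono_on {..n} u" "u ` {..n} \<subseteq> {a..b}"
    and B: "B < ennreal (\<Sum>k<n. dist (\<gamma> (u k)) (\<gamma> (u (Suc k))))"
    using variation_leI[of "{a..b}" \<gamma> B] by (meson not_le)
  define w where "w k = (if k = 0 then a else if k \<le> Suc n then u (k - 1) else b)" for k
  have "mono_on {..Suc (Suc n)} w"
    using u(2) assms by (auto intro!: mono_onI mono_onD[OF u(1)] simp: w_def image_subset_iff)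
  moreover have "(\<Sum>k<n. dist (\<gamma> (u k)) (\<gamma> (u (Suc k)))) = (\<Sum>k<n. dist (\<gamma> (w (Suc k))) (\<gamma> (w (Suc (Suc k)))))"
    by (rule sum.cong) (auto simp: w_def)
  then have "(\<Sum>k<n. dist (\<gamma> (u k)) (\<gamma> (u (Suc k)))) \<le> (\<Sum>k<Suc (Suc n). dist (\<gamma> (w k)) (\<gamma> (w (Suc k))))"
    by (subst sum.lessThan_Suc, subst sum.lessThan_Suc_shift) (simp add: add_increasing add_increasing2)
  then have "B < ennreal (\<Sum>k<Suc (Suc n). dist (\<gamma> (w k)) (\<gamma> (w (Suc k))))"
    using B ennreal_leI by (meson less_le_trans)
  ultimately show ?thesis
    by (intro that[of "Suc (Suc n)" w]) (auto simp: w_def)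
qed

section \<open>Covering estimates\<close>

text \<open>The pairs in \<open>K\<close> are centres and radii. Vitali selects disjoint balls whose
  fivefold enlargements cover all centres; an enlarged ball has length \<open>10 * snd i\<close>, at
  most \<open>10 / \<alpha>\<close> times \<open>F i\<close>, and the values \<open>F i\<close> of
  disjoint balls sum to at most \<open>B\<close>.\<close>

lemma weak_type_covering:
  fixes K :: "(real \<times> real) set" and F :: "real \<times> real \<Rightarrow> real"
  assumes pos: "0 < \<alpha>" and r: "\<And>i. i \<in> K \<Longrightarrow> 0 < snd i \<and> snd i \<le> R"
    and F: "\<And>i. i \<in> K \<Longrightarrow> \<alpha> * snd i \<le> F i"
    and B: "\<And>C. finite C \<Longrightarrow> C \<subseteq> K \<Longrightarrow>
      pairwise (\<lambda>i j. disjnt (cball (fst i) (snd i)) (cball (fst j) (snd j))) C \<Longrightarrow> sum F C \<le> B"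
  obtains T where "fst ` K \<subseteq> T" "T \<in> lmeasurable" "measure lebesgue T \<le> 10 * B / \<alpha>"
proof -
  have "fst ` K \<subseteq> (\<Union>i\<in>K. cball (fst i) (snd i))"
    using r by (force simp: image_subset_iff)
  then obtain C where C: "countable C" "C \<subseteq> K"
     "pairwise (\<lambda>i j. disjnt (cball (fst i) (snd i)) (cball (fst j) (snd j))) C"
     "fst ` K \<subseteq> (\<Union>i\<in>C. cball (fst i) (5 * snd i))"
    by (rule Vitali_covering_lemma_cballs[where r=snd and B=R]) (use r in auto)
  have bound: "measure lebesgue (\<Union>i\<in>D. cball (fst i) (5 * snd i)) \<le> 10 * B / \<alpha>"
    if D: "D \<subseteq> C" "finite D" for D
  proof -
    have "measure lebesgue (\<Union>i\<in>D. cball (fst i) (5 * snd i)) \<le> (\<Sum>i\<in>D. measure lebesgue (cball (fst i) (5 * snd i)))"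
      using D by (intro measure_UNION_le) auto
    also have "\<dots> \<le> (\<Sum>i\<in>D. 10 / \<alpha> * F i)"
    proof (rule sum_mono)
      fix i assume "i \<in> D"
      then have "i \<in> K" using D C by auto
      then show "measure lebesgue (cball (fst i) (5 * snd i)) \<le> 10 / \<alpha> * F i"
        using r[of i] F[of i] pos by (simp add: cball_eq_atLeastAtMost field_simps)
    qed
    also have "\<dots> = 10 / \<alpha> * sum F D" by (simp add: sum_distrib_left)
    also have "sum F D \<le> B"
      using D C by (intro B) (auto intro: pairwise_mono)
    then have "10 / \<alpha> * sum F D \<le> 10 * B / \<alpha>" using pos by (simp add: field_simps)
    finally show ?thesis .
  qed
  show ?thesis
  proof
    show "fst ` K \<subseteq> (\<Union>i\<in>C. cball (fst i) (5 * snd i))" by fact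
    show "(\<Union>i\<in>C. cball (fst i) (5 * snd i)) \<in> lmeasurable"
      by (rule fmeasurable_UN_bound[OF C(1) _ bound]) auto
    show "measure lebesgue (\<Union>i\<in>C. cball (fst i) (5 * snd i)) \<le> 10 * B / \<alpha>"
      by (rule measure_UN_bound[OF C(1) _ bound]) auto
  qed
qed

text \<open>Around a bad point of \<open>E\<close> there are arbitrarily small balls that carry mass
  more than \<open>\<alpha> * r\<close> off \<open>E\<close>. They can be taken inside an open
  \<open>U\<close> containing \<open>E\<close> with \<open>M (U - E)\<close> small, so disjoint ones
  have small total mass off \<open>E\<close>, and the weak-type bound makes the set of bad points
  small.\<close>

lemma AE_density_of_complement:
  fixes M :: "real measure"
  assumes M: "finite_measure M" "sets M = sets borel" and E: "E \<in> sets borel" and "0 < \<alpha>"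
  shows "AE t in lborel. t \<in> E \<longrightarrow> (\<exists>\<delta>>0. \<forall>r. 0 < r \<and> r < \<delta> \<longrightarrow> measure M (cball t r - E) \<le> \<alpha> * r)"
proof -
  interpret finite_measure M by fact
  have [measurable_cong, simp]: "sets M = sets borel" by fact
  have spM [simp]: "space M = UNIV" using sets_eq_imp_space_eq[OF M(2)] by simp
  let ?good = "\<lambda>t. \<exists>\<delta>>0. \<forall>r. 0 < r \<and> r < \<delta> \<longrightarrow> measure M (cball t r - E) \<le> \<alpha> * r"
  define S where "S = {t \<in> E. \<not> ?good t}"
  have "negligible S"
    unfolding negligible_outer_le
  proof (intro allI impI)
    fix e :: real assume "0 < e"
    \<comment> \<open>Chosen so that the bound \<open>10 * B / \<alpha>\<close> of the covering
      lemma equals \<open>e\<close>.\<close>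
    define B where "B = e * \<alpha> / 10"
    have "B > 0" using \<open>0 < e\<close> \<open>0 < \<alpha>\<close> by (simp add: B_def)
    then have "(INF U \<in> {U. E \<subseteq> U \<and> open U}. emeasure M U) < emeasure M E + ennreal B"
      using outer_regular[OF M(2) _ E] by (metis emeasure_finite ennreal_add_left_cancel_less
          add.right_neutral ennreal_less_zero_iff infinity_ennreal_def)
    then obtain U where U: "E \<subseteq> U" "open U" "emeasure M U < emeasure M E + ennreal B"
      by (auto simp: INF_less_iff)
    then have "measure M U < measure M E + B"
      using \<open>B > 0\<close> by (simp add: emeasure_eq_measure ennreal_less_iff flip: ennreal_plus)
    then have UE: "measure M (U - E) \<le> B"
      using U E by (subst finite_measure_Diff) auto
    \<comment> \<open>The condition \<open>r \<le> 1\<close> supplies the uniform radius bound that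
      the Vitali lemma requires.\<close>
    define K where "K = {(t, r). t \<in> S \<and> 0 < r \<and> r \<le> 1 \<and> cball t r \<subseteq> U \<and> \<alpha> * r < measure M (cball t r - E)}"
    have "S \<subseteq> fst ` K"
    proof
      fix t assume t: "t \<in> S"
      then have "t \<in> U" using U by (auto simp: S_def)
      then obtain d where d: "d > 0" "cball t d \<subseteq> U" using U open_contains_cball by blast
      have "min d 1 > 0" using d by simp
      then obtain r where r: "0 < r" "r < min d 1" "\<alpha> * r < measure M (cball t r - E)"
        using t unfolding S_def by (auto simp: not_le dest: spec[where x="min d 1"])
      then have "cball t r \<subseteq> U" using d subset_cball[of r d t] by auto
      then have "(t, r) \<in> K" using r t by (simp add: K_def)
      then show "t \<in> fst ` K" by force
    qed
    moreover obtain T where T: "fst ` K \<subseteq> T" "T \<in> lmeasurable" "measure lebesgue T \<le> 10 * B / \<alpha>"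
    proof (rule weak_type_covering[OF \<open>0 < \<alpha>\<close>, of K 1 "\<lambda>i. measure M (cball (fst i) (snd i) - E)" B])
      fix C assume C: "finite C" "C \<subseteq> K" "pairwise (\<lambda>i j. disjnt (cball (fst i) (snd i)) (cball (fst j) (snd j))) C"
      have "(\<Sum>i\<in>C. measure M (cball (fst i) (snd i) - E)) = measure M (\<Union>i\<in>C. cball (fst i) (snd i) - E)"
      proof (rule finite_measure_finite_Union[symmetric])
        show "disjoint_family_on (\<lambda>i. cball (fst i) (snd i) - E) C"
          unfolding disjoint_family_on_def
        proof (intro ballI impI)
          fix i j assume "i \<in> C" "j \<in> C" "i \<noteq> j"
          then have "disjnt (cball (fst i) (snd i)) (cball (fst j) (snd j))"
            using C(3) by (simp add: pairwise_def)
          then show "(cball (fst i) (snd i) - E) \<inter> (cball (fst j) (snd j) - E) = {}"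
            by (auto simp: disjnt_def)
        qed
      qed (use C E in auto)
      also have "\<dots> \<le> measure M (U - E)"
      proof (rule finite_measure_mono)
        have "cball (fst i) (snd i) \<subseteq> U" if "i \<in> C" for i
          using that C(2) by (force simp: K_def)
        then show "(\<Union>i\<in>C. cball (fst i) (snd i) - E) \<subseteq> U - E" by blast
      qed (use U E in auto)
      finally show "(\<Sum>i\<in>C. measure M (cball (fst i) (snd i) - E)) \<le> B" using UE by simp
    qed (auto simp: K_def)
    ultimately show "\<exists>T. S \<subseteq> T \<and> T \<in> lmeasurable \<and> measure lebesgue T \<le> e"
      using \<open>0 < \<alpha>\<close> by (auto simp: B_def intro!: exI[of _ T])
  qed
  then have "AE t in lebesgue. t \<notin> S"
    by (simp add: negligible_iff_null_sets AE_not_in)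
  then have "AE t in lborel. t \<notin> S"
    by (simp add: AE_completion_iff)
  then show ?thesis by eventually_elim (auto simp: S_def)
qed

text \<open>Induction on the number of intervals: split off the one with the largest left endpoint
  \<open>l i\<close>. By disjointness all others end before \<open>l i\<close>, so the induction
  hypothesis applies with \<open>l i\<close> in place of \<open>b\<close>.\<close>

lemma sum_increments_le:
  fixes g :: "real \<Rightarrow> real"
  assumes "finite C" "mono_on {a..b} g" "a \<le> b"
    and "\<And>i. i \<in> C \<Longrightarrow> a \<le> l i \<and> l i \<le> u i \<and> u i \<le> b"
    and "pairwise (\<lambda>i j. disjnt {l i..u i} {l j..u j}) C"
  shows "(\<Sum>i\<in>C. g (u i) - g (l i)) \<le> g b - g a"
  using assms
proof (induction "card C" arbitrary: C b)
  case 0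
  then show ?case by (auto dest: mono_onD)
next
  case (Suc n)
  then have "C \<noteq> {}" by auto
  then obtain i where i: "i \<in> C" "\<And>j. j \<in> C \<Longrightarrow> l j \<le> l i"
    using Suc.prems(1) Max_in[of "l ` C"] Max_ge[of "l ` C"] by fastforce
  have "u j \<le> l i" if "j \<in> C - {i}" for j
  proof -
    have "disjnt {l i..u i} {l j..u j}" using Suc.prems(5) that i by (auto simp: pairwise_def)
    moreover have "l j \<le> l i" "l i \<le> u i" using i that Suc.prems(4) by auto
    ultimately show ?thesis by (auto simp: disjnt_iff not_le dest: spec[of _ "l i"])
  qed
  moreover have "mono_on {a..l i} g"
    using Suc.prems(4)[OF i(1)] by (intro mono_on_subset[OF Suc.prems(2)]) auto
  ultimately have "(\<Sum>j\<in>C - {i}. g (u j) - g (l j)) \<le> g (l i) - g a"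
    using Suc.hyps(2) Suc.prems i(1) by (intro Suc.hyps(1)) (auto intro: pairwise_subset)
  moreover have "g (u i) \<le> g b"
    using Suc.prems(2,3,4) i(1) by (intro mono_onD[OF Suc.prems(2)]) force+
  ultimately show ?case
    using Suc.prems(1) i(1) by (simp add: sum.remove[of C i])
qed

section \<open>Chords and variation\<close>

locale bv_path =
  fixes I :: "real set" and \<gamma> :: "real \<Rightarrow> 'a::metric_space" and c :: real
  assumes conn: "connected I" and c_in: "c \<in> I" and lbv: "locally_bounded_variation I \<gamma>"
begin

abbreviation "V \<equiv> variation_from c \<gamma>"

lemma between: "s \<in> I \<Longrightarrow> t \<in> I \<Longrightarrow> s \<le> x \<Longrightarrow> x \<le> t \<Longrightarrow> x \<in> I"
  using conn connectedD_interval by blast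

text \<open>Local bounded variation makes \<open>enn2real\<close> lossless on compact subintervals,
  so additivity of the variation passes to real numbers. The three cases are the positions of the
  base point \<open>c\<close> relative to \<open>{s..t}\<close>, which decide the signs in
  \<open>V\<close>.\<close>

lemma variation_eq_V:
  assumes "s \<in> I" "t \<in> I" "s \<le> t"
  shows "variation \<gamma> {s..t} = ennreal (V t - V s)" "V s \<le> V t"
proof -
  have fin: "\<exists>r\<ge>0. variation \<gamma> {x..y} = ennreal r" if "x \<in> I" "y \<in> I" "x \<le> y" for x y
    using lbv that unfolding locally_bounded_variation_def
    by (metis ennreal_cases infinity_ennreal_def less_irrefl)
  have "variation \<gamma> {s..t} = ennreal (V t - V s) \<and> V s \<le> V t"
  proof -
    consider "c \<le> s" | "s < c" "c \<le> t" | "t < c" by linarith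
    then show ?thesis
    proof cases
      case 1
      then show ?thesis
        using fin[OF c_in assms(1)] fin[OF assms] variation_add[of c s t \<gamma>] assms(3)
        by (auto simp: variation_from_def simp flip: ennreal_plus)
    next
      case 2
      then show ?thesis
        using fin[OF assms(1) c_in] fin[OF c_in assms(2)] variation_add[of s c t \<gamma>]
        by (auto simp: variation_from_def add.commute simp flip: ennreal_plus)
    next
      case 3
      then show ?thesis
        using fin[OF assms(2) c_in] fin[OF assms] variation_add[of s t c \<gamma>] assms(3)
        by (auto simp: variation_from_def simp flip: ennreal_plus)
    qed
  qed
  then show "variation \<gamma> {s..t} = ennreal (V t - V s)" "V s \<le> V t" by auto
qed

lemma mono_V: "mono_on I V"
  by (intro mono_onI variation_eq_V)

lemma dist_le_V:
  assumes "s \<in> I" "t \<in> I" "s \<le> t"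
  shows "dist (\<gamma> s) (\<gamma> t) \<le> V t - V s"
  using dist_le_variation[of s "{s..t}" t \<gamma>] variation_eq_V[OF assms] assms(3)
  by (simp add: ennreal_le_iff)

text \<open>Distances are dominated by increments of \<open>V\<close>, so \<open>\<gamma>\<close> is
  continuous wherever the monotone \<open>V\<close> is. The countable set is used later to reduce
  the metric derivative to a limit along countably many points.\<close>

lemma countable_discontinuities: "countable (discontinuities I \<gamma>)"
proof (rule countable_subset)
  show "countable {a \<in> I. \<not> continuous (at a within I) V}"
    by (rule mono_on_ctble_discont[OF mono_V])
  have "continuous (at a within I) \<gamma>" if a: "a \<in> I" "continuous (at a within I) V" for a
    unfolding continuous_within
  proof (subst tendsto_dist_iff, rule tendsto_sandwich[OF always_eventually _ tendsto_const])
    show "((\<lambda>x. dist (V x) (V a)) \<longlongrightarrow> 0) (at a within I)"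
      using a(2) unfolding continuous_within by (rule iffD1[OF tendsto_dist_iff])
    show "\<forall>\<^sub>F x in at a within I. dist (\<gamma> x) (\<gamma> a) \<le> dist (V x) (V a)"
      unfolding eventually_at_filter
    proof (intro always_eventually allI impI)
      fix x assume "x \<in> I"
      then show "dist (\<gamma> x) (\<gamma> a) \<le> dist (V x) (V a)"
        using dist_le_V[of a x] dist_le_V[of x a] a
        by (cases "x \<le> a") (auto simp: dist_real_def dist_commute)
    qed
  qed auto
  then show "discontinuities I \<gamma> \<subseteq> {a \<in> I. \<not> continuous (at a within I) V}"
    by (auto simp: discontinuities_def)
qed

text \<open>
  Almost everywhere the chord \<open>dist (\<gamma> s) (\<gamma> t)\<close> exhausts the variation up to \<open>o(t - s)\<close>. Fix a
  partition whose chords miss less than \<open>B\<close> of the variation. On each of its gaps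
  \<open>(w k, w (k + 1))\<close> the function \<open>V - dist (\<gamma> (w k)) (\<gamma> \<cdot>)\<close> is nondecreasing, and its total
  increments over all gaps add up to less than \<open>B\<close>.
\<close>

lemma AE_variation_minus_chord:
  assumes "a \<in> I" "b \<in> I" "a < b" "0 < \<alpha>"
  shows "AE t in lborel. a < t \<and> t < b \<longrightarrow> (\<exists>\<delta>>0. \<forall>r. 0 < r \<and> r < \<delta> \<longrightarrow>
    V (t + r) - V t - dist (\<gamma> t) (\<gamma> (t + r)) \<le> \<alpha> * r \<and>
    V t - V (t - r) - dist (\<gamma> (t - r)) (\<gamma> t) \<le> \<alpha> * r)"
proof -
  let ?good = "\<lambda>t r. V (t + r) - V t - dist (\<gamma> t) (\<gamma> (t + r)) \<le> \<alpha> * r \<and>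
    V t - V (t - r) - dist (\<gamma> (t - r)) (\<gamma> t) \<le> \<alpha> * r"
  define S where "S = {t \<in> {a<..<b}. \<not> (\<exists>\<delta>>0. \<forall>r. 0 < r \<and> r < \<delta> \<longrightarrow> ?good t r)}"
  have "negligible S"
    unfolding negligible_outer_le
  proof (intro allI impI)
    fix e :: real assume "0 < e"
    define B where "B = e * \<alpha> / 10"
    have "B > 0" using \<open>0 < e\<close> \<open>0 < \<alpha>\<close> by (simp add: B_def)
    have "\<exists>n w. mono_on {..n} w \<and> w 0 = a \<and> w n = b \<and>
      V b - V a - B < (\<Sum>k<n. dist (\<gamma> (w k)) (\<gamma> (w (Suc k))))"
    proof -
      have V: "variation \<gamma> {a..b} = ennreal (V b - V a)" using variation_eq_V assms by auto
      show ?thesis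
      \<comment> \<open>A negative bound would become 0 in \<open>ennreal\<close>, and no partition
        need have a chord sum above 0. In that case the partition into the two points
        \<open>a\<close> and \<open>b\<close> will do.\<close>
      proof (cases "V b - V a - B < 0")
        case True
        define w :: "nat \<Rightarrow> real" where "w k = (if k = 0 then a else b)" for k
        have "mono_on {..1} w" "w 0 = a" "w 1 = b" using assms by (auto simp: w_def mono_on_def)
        moreover have "V b - V a - B < (\<Sum>k<1. dist (\<gamma> (w k)) (\<gamma> (w (Suc k))))"
          using True by (intro less_le_trans[OF True] sum_nonneg) auto
        ultimately show ?thesis by blast
      next
        case False
        then have "ennreal (V b - V a - B) < variation \<gamma> {a..b}"
          using \<open>B > 0\<close> by (auto simp: V ennreal_less_iff)
        then obtain n w where w: "mono_on {..n} w" "w 0 = a" "w n = b"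
          "ennreal (V b - V a - B) < ennreal (\<Sum>k<n. dist (\<gamma> (w k)) (\<gamma> (w (Suc k))))"
          by (rule variation_approx[OF less_imp_le[OF assms(3)]])
        then show ?thesis using False by (auto simp: ennreal_less_iff intro!: exI[of _ n] exI[of _ w])
      qed
    qed
    then obtain n w where w: "mono_on {..n} w" "w 0 = a" "w n = b"
      and sum_w: "V b - V a - B < (\<Sum>k<n. dist (\<gamma> (w k)) (\<gamma> (w (Suc k))))" by blast
    have w_le: "w k \<le> w (Suc k)" if "k < n" for k using that by (intro mono_onD[OF w(1)]) auto
    have wI: "w k \<in> I" if "k \<le> n" for k
      using w(2,3) mono_onD[OF w(1), of 0 k] mono_onD[OF w(1), of k n] that
      by (intro between[OF assms(1,2)]) auto
    define d where "d k = V (w (Suc k)) - V (w k) - dist (\<gamma> (w k)) (\<gamma> (w (Suc k)))" for k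
    have "\<exists>T. S \<inter> {w k<..<w (Suc k)} \<subseteq> T \<and> T \<in> lmeasurable \<and> measure lebesgue T \<le> 10 * d k / \<alpha>"
      if k: "k < n" for k
    proof -
      define g where "g t = V t - dist (\<gamma> (w k)) (\<gamma> t)" for t
      let ?l = "w k" and ?u = "w (Suc k)"
      \<comment> \<open>The chord defect over any subinterval is bounded by an increment of the one
        function \<open>g\<close>, by the triangle inequality through
        \<open>\<gamma> (w k)\<close>.\<close>
      have g_diff: "V t - V s - dist (\<gamma> s) (\<gamma> t) \<le> g t - g s" for s t
        using dist_triangle[of "\<gamma> ?l" "\<gamma> t" "\<gamma> s"] by (simp add: g_def)
      have inI: "x \<in> I" if "x \<in> {?l..?u}" for x
        using that k wI[of k] wI[of "Suc k"] by (auto intro: between)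
      have mono_g: "mono_on {?l..?u} g"
      proof (rule mono_onI)
        fix s t assume *: "s \<in> {?l..?u}" "t \<in> {?l..?u}" "s \<le> t"
        then show "g s \<le> g t" using g_diff[where s=s and t=t] dist_le_V[of s t] inI by auto
      qed
      define K where "K = {(t, r). t \<in> S \<and> 0 < r \<and> r \<le> 1 \<and> cball t r \<subseteq> {?l..?u} \<and> \<alpha> * r \<le> g (t + r) - g (t - r)}"
      have "S \<inter> {?l<..<?u} \<subseteq> fst ` K"
      proof
        fix t assume t: "t \<in> S \<inter> {?l<..<?u}"
        define \<delta> where "\<delta> = min 1 (min (t - ?l) (?u - t))"
        have "\<delta> > 0" using t by (auto simp: \<delta>_def)
        then obtain r where r: "0 < r" "r < \<delta>" "\<not> ?good t r" using t unfolding S_def by blast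
        then have sub: "cball t r \<subseteq> {?l..?u}" and in': "t - r \<in> {?l..?u}" "t \<in> {?l..?u}" "t + r \<in> {?l..?u}"
          by (auto simp: \<delta>_def cball_eq_atLeastAtMost)
        \<comment> \<open>At a bad radius at least one of the two half-increments of
          \<open>g\<close> exceeds \<open>\<alpha> * r\<close>; monotonicity of \<open>g\<close>
          makes the other nonnegative.\<close>
        have "\<alpha> * r \<le> g (t + r) - g (t - r)"
          using r(1,3) g_diff[where s=t and t="t+r"] g_diff[where s="t-r" and t=t]
            mono_onD[OF mono_g in'(1,2)] mono_onD[OF mono_g in'(2,3)]
          by auto
        then have "(t, r) \<in> K" using r t sub by (auto simp: K_def \<delta>_def)
        then show "t \<in> fst ` K" by force
      qed
      moreover obtain T where "fst ` K \<subseteq> T" "T \<in> lmeasurable" "measure lebesgue T \<le> 10 * d k / \<alpha>"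
      proof (rule weak_type_covering[OF \<open>0 < \<alpha>\<close>, of K 1 "\<lambda>i. g (fst i + snd i) - g (fst i - snd i)" "d k"])
        fix C assume C: "finite C" "C \<subseteq> K" "pairwise (\<lambda>i j. disjnt (cball (fst i) (snd i)) (cball (fst j) (snd j))) C"
        have "(\<Sum>i\<in>C. g (fst i + snd i) - g (fst i - snd i)) \<le> g ?u - g ?l"
        proof (rule sum_increments_le[OF C(1) mono_g w_le[OF k]])
          fix i assume "i \<in> C"
          then have "0 < snd i" "cball (fst i) (snd i) \<subseteq> {?l..?u}" using C(2) by (force simp: K_def)+
          then show "?l \<le> fst i - snd i \<and> fst i - snd i \<le> fst i + snd i \<and> fst i + snd i \<le> ?u"
            by (auto simp: cball_eq_atLeastAtMost)
        qed (use C(3) in \<open>simp add: cball_eq_atLeastAtMost\<close>)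
        then show "(\<Sum>i\<in>C. g (fst i + snd i) - g (fst i - snd i)) \<le> d k"
          by (simp add: g_def d_def)
      qed (auto simp: K_def)
      ultimately show ?thesis by blast
    qed
    then have "\<forall>k. \<exists>T. k < n \<longrightarrow> S \<inter> {w k<..<w (Suc k)} \<subseteq> T \<and> T \<in> lmeasurable \<and>
        measure lebesgue T \<le> 10 * d k / \<alpha>" by blast
    from choice[OF this] obtain T where "\<forall>k. k < n \<longrightarrow> S \<inter> {w k<..<w (Suc k)} \<subseteq> T k \<and> T k \<in> lmeasurable \<and>
        measure lebesgue (T k) \<le> 10 * d k / \<alpha>" ..
    then have T: "\<And>k. k < n \<Longrightarrow> S \<inter> {w k<..<w (Suc k)} \<subseteq> T k"
      "\<And>k. k < n \<Longrightarrow> T k \<in> lmeasurable" "\<And>k. k < n \<Longrightarrow> measure lebesgue (T k) \<le> 10 * d k / \<alpha>"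
      by simp_all
    \<comment> \<open>The covering argument needs room around \<open>t\<close> inside a gap, so it
      says nothing about partition points; these are finitely many and hence negligible.\<close>
    have cover: "t \<in> w ` {..m} \<or> (\<exists>k<m. t \<in> {w k<..<w (Suc k)})" if "w 0 \<le> t" "t \<le> w m" for t m
      using that
    proof (induction m)
      case (Suc m)
      show ?case
      proof (cases "t \<le> w m")
        case True
        with Suc have "t \<in> w ` {..m} \<or> (\<exists>k<m. t \<in> {w k<..<w (Suc k)})" by blast
        then show ?thesis by (auto simp: atMost_Suc intro: less_SucI)
      next
        case False
        with Suc.prems show ?thesis by (cases "t = w (Suc m)") (auto intro!: exI[of _ m])
      qed
    qed auto
    have neg: "negligible (w ` {..n})" by (intro negligible_finite) auto
    show "\<exists>T. S \<subseteq> T \<and> T \<in> lmeasurable \<and> measure lebesgue T \<le> e"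
    proof (intro exI conjI)
      show "S \<subseteq> w ` {..n} \<union> (\<Union>k<n. T k)"
      proof
        fix t assume t: "t \<in> S"
        then have "w 0 \<le> t" "t \<le> w n" using w by (auto simp: S_def)
        from cover[OF this] show "t \<in> w ` {..n} \<union> (\<Union>k<n. T k)" using T(1) t by blast
      qed
      have meas: "(\<Union>k<n. T k) \<in> lmeasurable" using T(2) by (intro fmeasurable.finite_UN) auto
      then show "w ` {..n} \<union> (\<Union>k<n. T k) \<in> lmeasurable"
        using neg negligible_imp_measurable by blast
      have "measure lebesgue (w ` {..n} \<union> (\<Union>k<n. T k)) \<le> measure lebesgue (w ` {..n}) + measure lebesgue (\<Union>k<n. T k)"
        using neg meas by (intro measure_Un_le) (auto simp: negligible_imp_sets)
      also have "\<dots> = measure lebesgue (\<Union>k<n. T k)"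
        using neg by (simp add: negligible_imp_measure0)
      also have "\<dots> \<le> (\<Sum>k<n. measure lebesgue (T k))"
        using T(2) by (intro measure_UNION_le) auto
      also have "\<dots> \<le> (\<Sum>k<n. 10 / \<alpha> * d k)" using T(3) by (intro sum_mono) auto
      also have "\<dots> = 10 / \<alpha> * (\<Sum>k<n. d k)" by (rule sum_distrib_left[symmetric])
      \<comment> \<open>The increments of \<open>V\<close> along \<open>w\<close> telescope to
        \<open>V b - V a\<close>, so the defects \<open>d k\<close> sum to \<open>V b - V a\<close>
        minus the chord sum, which is below \<open>B\<close>.\<close>
      also have "\<dots> \<le> 10 / \<alpha> * B"
        using sum_lessThan_telescope[of "\<lambda>k. V (w k)" n] w(2,3) sum_w \<open>0 < \<alpha>\<close>
        by (intro mult_left_mono) (auto simp: d_def sum_subtractf)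
      also have "\<dots> = e" using \<open>0 < \<alpha>\<close> by (simp add: B_def)
      finally show "measure lebesgue (w ` {..n} \<union> (\<Union>k<n. T k)) \<le> e" .
    qed
  qed
  then have "AE t in lebesgue. t \<notin> S"
    by (simp add: negligible_iff_null_sets AE_not_in)
  then have "AE t in lborel. t \<notin> S"
    by (simp add: AE_completion_iff)
  then show ?thesis by eventually_elim (auto simp: S_def)
qed

end

section \<open>Lebesgue-Stieltjes measures on intervals\<close>

lemma borel_connected: "connected I \<Longrightarrow> I \<in> sets borel" for I :: "real set"
  by (rule real_interval_borel_measurable) (simp add: is_interval_connected_1)

lemma finite_if_unique: "(\<And>x y. x \<in> A \<Longrightarrow> y \<in> A \<Longrightarrow> x = y) \<Longrightarrow> finite A"
proof (cases "A = {}")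
  case False
  assume *: "\<And>x y. x \<in> A \<Longrightarrow> y \<in> A \<Longrightarrow> x = y"
  obtain x where "x \<in> A" using False by auto
  with * have "A = {x}" by blast
  then show ?thesis by simp
qed simp

text \<open>The rational points of \<open>I\<close> suffice except at a maximum of \<open>I\<close>,
  which may be irrational and is therefore added. The set serves to exhaust an interval by countably
  many subintervals with endpoints in it.\<close>

lemma interval_countable_cofinal:
  fixes I :: "real set"
  assumes "connected I"
  obtains C where "countable C" "C \<subseteq> I"
    "\<forall>x\<in>I. (\<exists>t\<in>C. x \<le> t) \<and> ((\<exists>s\<in>C. s < x) \<or> (\<forall>y\<in>I. x \<le> y))"
proof
  let ?mx = "{x \<in> I. \<forall>y\<in>I. y \<le> x}"
  let ?C = "(I \<inter> \<rat>) \<union> ?mx"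
  have "countable ?mx" by (intro countable_finite finite_if_unique) (auto intro: order_antisym)
  then show "countable ?C" by (simp add: countable_rat countable_Int2)
  show "?C \<subseteq> I" by auto
  show "\<forall>x\<in>I. (\<exists>t\<in>?C. x \<le> t) \<and> ((\<exists>s\<in>?C. s < x) \<or> (\<forall>y\<in>I. x \<le> y))"
  proof
    fix x assume x: "x \<in> I"
    have mid: "\<exists>q\<in>?C. y < q \<and> q < z" if yz: "y \<in> I" "z \<in> I" "y < z" for y z
    proof -
      obtain q where q: "q \<in> \<rat>" "y < q" "q < z" using Rats_dense_in_real[OF yz(3)] by auto
      then have "q \<in> I" using yz connectedD_interval[OF assms, of y z q] by simp
      then show ?thesis using q by auto
    qed
    have "\<exists>t\<in>?C. x \<le> t"
    proof (cases "\<forall>y\<in>I. y \<le> x")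
      case True
      then show ?thesis using x by auto
    next
      case False
      then obtain y where "y \<in> I" "x < y" by (auto simp: not_le)
      from mid[OF x this] show ?thesis using less_imp_le by blast
    qed
    moreover have "(\<exists>s\<in>?C. s < x) \<or> (\<forall>y\<in>I. x \<le> y)"
    proof (cases "\<forall>y\<in>I. x \<le> y")
      case False
      then obtain y where "y \<in> I" "y < x" by (auto simp: not_le)
      from mid[OF this(1) x this(2)] show ?thesis by blast
    qed simp
    ultimately show "(\<exists>t\<in>?C. x \<le> t) \<and> ((\<exists>s\<in>?C. s < x) \<or> (\<forall>y\<in>I. x \<le> y))" ..
  qed
qed

text \<open>These are the sets whose measure the Lebesgue-Stieltjes characterization prescribes. A
  half-open interval with endpoints in \<open>I\<close> never contains the minimum of
  \<open>I\<close>, hence the extra singleton.\<close>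

definition Ioc_generator :: "real set \<Rightarrow> real set set" where
  "Ioc_generator I = {{s<..t} |s t. s \<in> I \<and> t \<in> I} \<union> {{a} |a. a \<in> I \<and> (\<forall>t\<in>I. a \<le> t)}"

lemma Ioc_generator_cases [consumes 1, case_names Ioc min]:
  assumes "A \<in> Ioc_generator I"
  obtains s t where "A = {s<..t}" "s \<in> I" "t \<in> I" | a where "A = {a}" "a \<in> I" "\<forall>t\<in>I. a \<le> t"
  using assms unfolding Ioc_generator_def by blast

lemma Ioc_generatorI:
  "s \<in> I \<Longrightarrow> t \<in> I \<Longrightarrow> {s<..t} \<in> Ioc_generator I"
  "a \<in> I \<Longrightarrow> \<forall>t\<in>I. a \<le> t \<Longrightarrow> {a} \<in> Ioc_generator I"
  unfolding Ioc_generator_def by blast+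

lemma Ioc_subset: "connected I \<Longrightarrow> s \<in> I \<Longrightarrow> t \<in> I \<Longrightarrow> {s<..t} \<subseteq> I" for I :: "real set"
  using connectedD_interval[of I s t] by auto

lemma Ioc_generator_subset: "connected I \<Longrightarrow> Ioc_generator I \<subseteq> Pow I"
proof (intro subsetI PowI)
  fix A x assume "connected I" "A \<in> Ioc_generator I" "x \<in> A"
  from this(2,1,3) show "x \<in> I" by (cases rule: Ioc_generator_cases) (use Ioc_subset in blast)+
qed

text \<open>Half-open intervals with endpoints in a countable cofinal set reach every point except a
  possible minimum. Such a cover by sets of finite measure is what the uniqueness theorem for
  measures asks for.\<close>

lemma Ioc_generator_cover:
  assumes "connected I"
  obtains A where "A \<subseteq> Ioc_generator I" "\<Union>A = I" "countable A"
proof -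
  obtain C where C: "countable C" "C \<subseteq> I"
    "\<forall>x\<in>I. (\<exists>t\<in>C. x \<le> t) \<and> ((\<exists>s\<in>C. s < x) \<or> (\<forall>y\<in>I. x \<le> y))"
    by (rule interval_countable_cofinal[OF assms])
  let ?mn = "{a \<in> I. \<forall>t\<in>I. a \<le> t}"
  have mn: "countable ?mn" by (intro countable_finite finite_if_unique) (auto intro: order_antisym)
  let ?A = "(\<lambda>(s,t). {s<..t}) ` (C \<times> C) \<union> (\<lambda>a. {a}) ` ?mn"
  show ?thesis
  proof
    show "?A \<subseteq> Ioc_generator I" using C(2) by (auto intro!: Ioc_generatorI)
    show "countable ?A" using C(1) mn by blast
    show "\<Union>?A = I"
    proof
      show "\<Union>?A \<subseteq> I" using C(2) Ioc_subset[OF assms] by blast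
      show "I \<subseteq> \<Union>?A"
      proof
        fix x assume x: "x \<in> I"
        then obtain t where t: "t \<in> C" "x \<le> t" using C(3) by blast
        from C(3) x consider s where "s \<in> C" "s < x" | "\<forall>y\<in>I. x \<le> y" by blast
        then show "x \<in> \<Union>?A"
        proof cases
          case 1
          with t show ?thesis by (intro UnionI[of "{s<..t}"]) auto
        next
          case 2
          with x show ?thesis by (intro UnionI[of "{x}"]) auto
        qed
      qed
    qed
  qed
qed

lemma Int_stable_Ioc_generator:
  assumes "I \<noteq> {}"
  shows "Int_stable (Ioc_generator I)"
proof -
  obtain c where "c \<in> I" using assms by auto
  \<comment> \<open>The empty set arises as a degenerate interval, which requires a point of
    \<open>I\<close>.\<close>
  then have "{c<..c} \<in> Ioc_generator I" unfolding Ioc_generator_def by blast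
  then have emp: "{} \<in> Ioc_generator I" by simp
  have 1: "{s<..t} \<inter> {s'<..t'} \<in> Ioc_generator I" if "s \<in> I" "t \<in> I" "s' \<in> I" "t' \<in> I" for s t s' t'
  proof -
    have "{s<..t} \<inter> {s'<..t'} = {max s s'<..min t t'}" by auto
    moreover have "max s s' \<in> I" "min t t' \<in> I" using that by (auto simp: max_def min_def)
    ultimately show ?thesis unfolding Ioc_generator_def by blast
  qed
  have 2: "{s<..t} \<inter> {a} = {}" if "s \<in> I" "\<forall>t\<in>I. a \<le> t" for s t a
    using that by force
  show ?thesis
  proof (rule Int_stableI)
    fix A B assume A: "A \<in> Ioc_generator I" and B: "B \<in> Ioc_generator I"
    from A show "A \<inter> B \<in> Ioc_generator I"
    proof (cases rule: Ioc_generator_cases)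
      case st: (Ioc s t)
      from B show ?thesis
      proof (cases rule: Ioc_generator_cases)
        case (Ioc s' t')
        then show ?thesis using 1 st by simp
      next
        case (min a)
        then have "A \<inter> B = {}" using 2 st by blast
        then show ?thesis using emp by simp
      qed
    next
      case a: (min a)
      from B show ?thesis
      proof (cases rule: Ioc_generator_cases)
        case (Ioc s t)
        then have "A \<inter> B = {}" using 2 a by blast
        then show ?thesis using emp by simp
      next
        case (min b)
        then have "a = b" using a by (blast intro: order_antisym)
        then show ?thesis using A a min by simp
      qed
    qed
  qed
qed

text \<open>The trace of \<open>{l<..u}\<close> on \<open>I\<close> need not be a generator, as
  \<open>l\<close> and \<open>u\<close> may lie outside \<open>I\<close>. Cut by a member
  \<open>{s<..t}\<close> of the countable cover it has endpoints \<open>max s l\<close> and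
  \<open>min t u\<close>, which lie in \<open>I\<close> unless the intersection is empty.\<close>

lemma sets_borel_on_eq_sigma_sets:
  assumes "connected I" "I \<noteq> {}"
  shows "sets (borel_on I) = sigma_sets I (Ioc_generator I)"
proof -
  define N where "N = sigma I (Ioc_generator I)"
  have sub: "Ioc_generator I \<subseteq> Pow I"
    by (rule Ioc_generator_subset[OF assms(1)])
  have N: "sets N = sigma_sets I (Ioc_generator I)" "space N = I"
    using sub by (simp_all add: N_def)
  have gen: "A \<in> sets N" if "A \<in> Ioc_generator I" for A using that N by auto
  obtain A where A: "A \<subseteq> Ioc_generator I" "\<Union>A = I" "countable A"
    by (rule Ioc_generator_cover[OF assms(1)])
  have borel: "sets borel = sigma_sets UNIV (range (\<lambda>(a, b). {a <.. b::real}))"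
    by (subst borel_sigma_sets_Ioc) simp
  have restrict: "sets (borel_on I) = sigma_sets I ((\<inter>) I ` range (\<lambda>(a, b). {a <.. b}))"
    using borel_connected[OF assms(1)] unfolding sets_restrict_space borel
    by (intro sigma_sets_Int) auto
  also have "\<dots> = sigma_sets I (Ioc_generator I)"
  proof (rule sigma_sets_eqI)
    fix B assume "B \<in> (\<inter>) I ` range (\<lambda>(a, b). {a <.. b})"
    then obtain l u where B: "B = I \<inter> {l<..u}" by auto
    have "X \<inter> {l<..u} \<in> sets N" if X: "X \<in> Ioc_generator I" for X
      using X
    proof (cases rule: Ioc_generator_cases)
      case (Ioc s t)
      then have eq: "X \<inter> {l<..u} = {max s l<..min t u}" by auto
      show ?thesis
      proof (cases "max s l < min t u")
        case True
        then have "max s l \<in> I" "min t u \<in> I" using Ioc connectedD_interval[OF assms(1), of s t] by auto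
        then show ?thesis unfolding eq by (intro gen Ioc_generatorI)
      next
        case False
        then have "{max s l<..min t u} = {}" by (intro greaterThanAtMost_empty leI)
        then show ?thesis unfolding eq by (simp only: sets.empty_sets)
      qed
    next
      case (min a)
      then show ?thesis using gen[OF X] by (cases "a \<in> {l<..u}") auto
    qed
    then have "(\<Union>X\<in>A. X \<inter> {l<..u}) \<in> sets N"
      using A by (intro sets.countable_UN') auto
    moreover have "(\<Union>X\<in>A. X \<inter> {l<..u}) = B" using A(2) B by auto
    ultimately show "B \<in> sigma_sets I (Ioc_generator I)" using N by simp
  next
    fix B assume B: "B \<in> Ioc_generator I"
    then have "B \<in> sets borel" by (auto elim!: Ioc_generator_cases)
    then have "B \<in> sets (borel_on I)" using sub B by (auto simp: sets_restrict_space)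
    then show "B \<in> sigma_sets I ((\<inter>) I ` range (\<lambda>(a, b). {a <.. b}))"
      by (simp only: restrict)
  qed
  finally show ?thesis .
qed

text \<open>
  The measure is the image of Lebesgue measure under the generalized inverse
  \<open>\<phi> y = inf {t \<in> I. y \<le> v t}\<close>, which satisfies \<open>\<phi> y \<le> t \<longleftrightarrow> y \<le> v t\<close>.
\<close>

lemma stieltjes_measure_exists:
  fixes I :: "real set" and v :: "real \<Rightarrow> real"
  assumes conn: "connected I" and v: "mono_on I v"
    and rc: "\<forall>t\<in>I. (\<exists>u\<in>I. t < u) \<longrightarrow> (\<forall>y. (\<forall>u\<in>I. t < u \<longrightarrow> y \<le> v u) \<longrightarrow> y \<le> v t)"
  shows "\<exists>\<mu>. space \<mu> = I \<and> sets \<mu> = sets (borel_on I) \<and>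
     (\<forall>s\<in>I. \<forall>t\<in>I. s \<le> t \<longrightarrow> emeasure \<mu> {s<..t} = ennreal (v t - v s)) \<and>
     (\<forall>a\<in>I. (\<forall>t\<in>I. a \<le> t) \<longrightarrow> emeasure \<mu> {a} = 0)"
proof -
  note v_mono = mono_onD[OF v]
  \<comment> \<open>The levels that \<open>v\<close> passes within \<open>I\<close>: for them the
    set defining \<open>\<phi> y\<close> is nonempty and bounded below by a point of
    \<open>I\<close>, so that \<open>\<phi> y\<close> lies in \<open>I\<close>, whether or not
    \<open>v\<close> is bounded.\<close>
  define W where "W = {y. \<exists>s\<in>I. \<exists>t\<in>I. v s < y \<and> y \<le> v t}"
  define \<phi> where "\<phi> y = Inf {t \<in> I. y \<le> v t}" for y
  have W: "W \<in> sets borel"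
  proof (rule real_interval_borel_measurable)
    show "is_interval W"
      unfolding is_interval_1 W_def by (smt (verit) mem_Collect_eq)
  qed
  have ne: "{t \<in> I. y \<le> v t} \<noteq> {}" "bdd_below {t \<in> I. y \<le> v t}" "\<phi> y \<in> I" if y: "y \<in> W" for y
  proof -
    obtain s t where st: "s \<in> I" "t \<in> I" "v s < y" "y \<le> v t" using y by (auto simp: W_def)
    have s: "s \<le> x" if "x \<in> {t \<in> I. y \<le> v t}" for x
      using that v_mono[of x s] st by force
    show 1: "{t \<in> I. y \<le> v t} \<noteq> {}" using st by auto
    show 2: "bdd_below {t \<in> I. y \<le> v t}" using s by (rule bdd_belowI)
    have "s \<le> \<phi> y" unfolding \<phi>_def using s 1 by (intro cInf_greatest) auto
    moreover have "\<phi> y \<le> t" unfolding \<phi>_def using st 2 by (intro cInf_lower) auto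
    ultimately show "\<phi> y \<in> I" using connectedD_interval[OF conn st(1,2)] by auto
  qed
  have \<phi>_le: "\<phi> y \<le> t \<longleftrightarrow> y \<le> v t" if y: "y \<in> W" and t: "t \<in> I" for y t
  proof
    assume "y \<le> v t"
    then show "\<phi> y \<le> t" unfolding \<phi>_def using t ne(2)[OF y] by (intro cInf_lower) auto
  next
    assume le: "\<phi> y \<le> t"
    \<comment> \<open>Right continuity in the form \<open>rc\<close> passes from all
      \<open>u\<close> above \<open>t\<close> to \<open>t\<close> itself, so that the infimum is
      attained. If \<open>t\<close> is the maximum of \<open>I\<close>, monotonicity does
      this.\<close>
    have above: "y \<le> v u" if u: "u \<in> I" "t < u" for u
    proof -
      have "Inf {t \<in> I. y \<le> v t} < u" using le u by (simp add: \<phi>_def)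
      then obtain x where "x \<in> I" "y \<le> v x" "x < u" using cInf_lessD[OF ne(1)[OF y]] by auto
      then show ?thesis using v_mono[of x u] u by auto
    qed
    show "y \<le> v t"
    proof (cases "\<exists>u\<in>I. t < u")
      case True
      then show ?thesis using rc t above by blast
    next
      case False
      obtain x where "x \<in> I" "y \<le> v x" using ne(1)[OF y] by auto
      then show ?thesis using False v_mono[of x t] t by force
    qed
  qed
  have \<phi>_mono: "mono_on W \<phi>"
  proof (rule mono_onI)
    fix r s assume "r \<in> W" "s \<in> W" "r \<le> s"
    then show "\<phi> r \<le> \<phi> s" using \<phi>_le[of r "\<phi> s"] \<phi>_le[of s "\<phi> s"] ne(3)[of s] by auto
  qed
  have [measurable]: "\<phi> \<in> restrict_space lborel W \<rightarrow>\<^sub>M borel_on I"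
  proof (rule measurable_restrict_space2)
    show "\<phi> \<in> space (restrict_space lborel W) \<rightarrow> I" using ne(3) by (auto simp: space_restrict_space)
    show "\<phi> \<in> restrict_space lborel W \<rightarrow>\<^sub>M borel"
      using borel_measurable_mono_on_fnc[OF \<phi>_mono]
      by (simp cong: measurable_cong_sets add: sets_restrict_space)
  qed
  define \<mu> where "\<mu> = distr (restrict_space lborel W) (borel_on I) \<phi>"
  have em: "emeasure \<mu> A = emeasure lborel {y \<in> W. \<phi> y \<in> A}" if "A \<in> sets (borel_on I)" for A
    unfolding \<mu>_def using that W
    by (subst emeasure_distr) (auto simp: space_restrict_space emeasure_restrict_space intro!: arg_cong[where f="emeasure lborel"])
  show ?thesis
  proof (intro exI conjI ballI impI)
    show "space \<mu> = I" "sets \<mu> = sets (borel_on I)" by (simp_all add: \<mu>_def space_restrict_space)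
    fix s t assume st: "s \<in> I" "t \<in> I" "s \<le> t"
    then have "{s<..t} \<subseteq> I" using connectedD_interval[OF conn st(1,2)] by auto
    then have "{s<..t} \<in> sets (borel_on I)" by (auto simp: sets_restrict_space)
    moreover have "{y \<in> W. \<phi> y \<in> {s<..t}} = {v s<..v t}"
      using \<phi>_le st by (fastforce simp: W_def simp flip: not_le)
    ultimately show "emeasure \<mu> {s<..t} = ennreal (v t - v s)"
      using em v_mono[OF st] by simp
  next
    fix a assume a: "a \<in> I" "\<forall>t\<in>I. a \<le> t"
    then have "{a} \<in> sets (borel_on I)" by (auto simp: sets_restrict_space intro!: image_eqI[of _ _ "{a}"])
    \<comment> \<open>Every level in \<open>W\<close> exceeds some value of \<open>v\<close>, hence
      also \<open>v a\<close>, so the inverse never takes the value \<open>a\<close>. This is the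
      convention of no mass at the minimum.\<close>
    moreover have "{y \<in> W. \<phi> y \<in> {a}} = {}"
    proof -
      have False if y: "y \<in> W" "\<phi> y = a" for y
      proof -
        have "y \<le> v a" using \<phi>_le[OF y(1) a(1)] y(2) by simp
        moreover obtain s where "s \<in> I" "v s < y" using y(1) by (auto simp: W_def)
        ultimately show False using v_mono[of a s] a by auto
      qed
      then show ?thesis by auto
    qed
    ultimately show "emeasure \<mu> {a} = 0" by (simp only: em emeasure_empty)
  qed
qed

text \<open>The definite description has a meaning only after existence, settled by the image
  measure above, and uniqueness: the prescribed values are finite, the generator is closed under
  intersection, and countably many of its members cover \<open>I\<close>.\<close>

lemma lebesgue_stieltjes_on:
  fixes I :: "real set" and v :: "real \<Rightarrow> real"
  assumes conn: "connected I" and ne: "I \<noteq> {}" and v: "mono_on I v"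
    and rc: "\<forall>t\<in>I. (\<exists>u\<in>I. t < u) \<longrightarrow> (\<forall>y. (\<forall>u\<in>I. t < u \<longrightarrow> y \<le> v u) \<longrightarrow> y \<le> v t)"
  shows "sets (lebesgue_stieltjes_on I v) = sets (borel_on I)"
    "\<And>s t. s \<in> I \<Longrightarrow> t \<in> I \<Longrightarrow> s \<le> t \<Longrightarrow> emeasure (lebesgue_stieltjes_on I v) {s<..t} = ennreal (v t - v s)"
    "\<And>a. a \<in> I \<Longrightarrow> \<forall>t\<in>I. a \<le> t \<Longrightarrow> emeasure (lebesgue_stieltjes_on I v) {a} = 0"
proof -
  let ?P = "\<lambda>\<mu>. space \<mu> = I \<and> sets \<mu> = sets (borel_on I) \<and>
     (\<forall>s\<in>I. \<forall>t\<in>I. s \<le> t \<longrightarrow> emeasure \<mu> {s<..t} = ennreal (v t - v s)) \<and>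
     (\<forall>a\<in>I. (\<forall>t\<in>I. a \<le> t) \<longrightarrow> emeasure \<mu> {a} = 0)"
  obtain \<mu> where \<mu>: "?P \<mu>"
    using stieltjes_measure_exists[OF conn v rc] by (rule exE)
  \<comment> \<open>One formula in terms of the set alone covers both kinds of generator: for a
    singleton, \<open>Sup\<close> and \<open>Inf\<close> agree and the value is 0.\<close>
  have gen: "emeasure M A = (if A = {} then 0 else ennreal (v (Sup A) - v (Inf A)))" if "A \<in> Ioc_generator I" "?P M" for M A
    using that by (elim Ioc_generator_cases) (auto simp: not_less)
  obtain A where A: "A \<subseteq> Ioc_generator I" "\<Union>A = I" "countable A"
    by (rule Ioc_generator_cover[OF conn])
  have unique: "M = \<mu>" if M: "?P M" for M
  proof (rule measure_eqI_generator_eq_countable[OF Int_stable_Ioc_generator[OF ne] _ _ _ _ A])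
    show "Ioc_generator I \<subseteq> Pow I"
      by (rule Ioc_generator_subset[OF conn])
    show "sets M = sigma_sets I (Ioc_generator I)" "sets \<mu> = sigma_sets I (Ioc_generator I)"
      using M \<mu> sets_borel_on_eq_sigma_sets[OF conn ne] by auto
    show "emeasure M X = emeasure \<mu> X" if "X \<in> Ioc_generator I" for X
      using gen[OF that M] gen[OF that \<mu>] by simp
    show "emeasure M X \<noteq> \<infinity>" if "X \<in> A" for X
    proof -
      have "X \<in> Ioc_generator I" using A(1) that by blast
      from gen[OF this M] show ?thesis by simp
    qed
  qed
  have "?P (THE \<mu>. ?P \<mu>)" by (rule theI[where P="?P", OF \<mu> unique])
  then have "?P (lebesgue_stieltjes_on I v)" unfolding lebesgue_stieltjes_on_def .
  then show "sets (lebesgue_stieltjes_on I v) = sets (borel_on I)"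
    "\<And>s t. s \<in> I \<Longrightarrow> t \<in> I \<Longrightarrow> s \<le> t \<Longrightarrow> emeasure (lebesgue_stieltjes_on I v) {s<..t} = ennreal (v t - v s)"
    "\<And>a. a \<in> I \<Longrightarrow> \<forall>t\<in>I. a \<le> t \<Longrightarrow> emeasure (lebesgue_stieltjes_on I v) {a} = 0" by blast+
qed

section \<open>The speed measure\<close>

lemma seq_to_left_endpoint:
  fixes l s :: real
  assumes "l < s"
  obtains x :: "nat \<Rightarrow> real" where "\<And>n. l \<le> x n" "\<And>n. x n < s" "incseq x" "x \<longlonglongrightarrow> s"
proof
  let ?x = "\<lambda>n. s - (s - l) / real (Suc n)"
  show "l \<le> ?x n" "?x n < s" for n
    using assms mult_right_mono[of 1 "real (Suc n)" "s - l"] by (simp_all add: field_simps)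
  show "incseq ?x" using assms by (auto simp: incseq_def intro!: divide_left_mono)
  have "(\<lambda>n. s - (s - l) * inverse (real (Suc n))) \<longlonglongrightarrow> s - (s - l) * 0"
    by (intro tendsto_intros LIMSEQ_inverse_real_of_nat)
  then show "?x \<longlonglongrightarrow> s" by (simp add: divide_inverse)
qed

context bv_path
begin

abbreviation "v \<equiv> right_limit_on I V"
abbreviation "\<nu> \<equiv> speed_measure I c \<gamma>"

lemma I_borel [measurable]: "I \<in> sets borel"
  by (rule borel_connected[OF conn])

lemma V_le: "s \<in> I \<Longrightarrow> t \<in> I \<Longrightarrow> s \<le> t \<Longrightarrow> V s \<le> V t"
  by (rule variation_eq_V)

lemma v_max: "\<forall>s\<in>I. s \<le> t \<Longrightarrow> v t = V t"
  by (simp add: right_limit_on_def)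

text \<open>The right limit is taken on the whole line, but \<open>I\<close> contains all points
  between \<open>t\<close> and \<open>u\<close>, so only values on \<open>I\<close> count, and by
  monotonicity their limit is an infimum.\<close>

lemma v_eq_Inf:
  assumes t: "t \<in> I" and u: "u \<in> I" "t < u"
  shows "v t = Inf (V ` ({t<..} \<inter> I))"
proof -
  have "(V \<longlongrightarrow> Inf (V ` ({t<..} \<inter> I))) (at t within ({t<..} \<inter> I))"
    using V_le t by (intro Lim_right_bound[where K="V t"]) auto
  moreover have "at t within ({t<..} \<inter> I) = at_right t"
    using u by (intro at_within_nhd[of _ "{..<u}"]) (auto intro: between[OF t u(1)])
  ultimately have "Lim (at_right t) V = Inf (V ` ({t<..} \<inter> I))"
    by (intro tendsto_Lim) auto
  then show ?thesis using u by (auto simp: right_limit_on_def not_le)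
qed

lemma V_le_v: "t \<in> I \<Longrightarrow> V t \<le> v t"
proof (cases "\<forall>s\<in>I. s \<le> t")
  case False
  assume t: "t \<in> I"
  from False obtain u where u: "u \<in> I" "t < u" by (auto simp: not_le)
  show ?thesis unfolding v_eq_Inf[OF t u] using u V_le t by (intro cInf_greatest) auto
qed (simp add: v_max)

lemma v_le_V:
  assumes "s \<in> I" "t \<in> I" "s < t"
  shows "v s \<le> V t"
  unfolding v_eq_Inf[OF assms]
  using assms V_le by (intro cInf_lower bdd_belowI[where m="V s"]) auto

lemma mono_v: "mono_on I v"
proof (rule mono_onI)
  fix s t assume "s \<in> I" "t \<in> I" "s \<le> t"
  then show "v s \<le> v t"
    using v_le_V[of s t] V_le_v[of t] by (cases "s = t") auto
qed

text \<open>A point \<open>m\<close> strictly between \<open>t\<close> and \<open>x\<close>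
  satisfies \<open>v m \<le> V x\<close>, so a lower bound of \<open>v\<close> to the right of
  \<open>t\<close> is one of \<open>V\<close> there, and \<open>v t\<close> is the greatest of
  these.\<close>

lemma v_right_continuous:
  "\<forall>t\<in>I. (\<exists>u\<in>I. t < u) \<longrightarrow> (\<forall>y. (\<forall>u\<in>I. t < u \<longrightarrow> y \<le> v u) \<longrightarrow> y \<le> v t)"
proof (intro ballI allI impI)
  fix t y assume t: "t \<in> I" and "\<exists>u\<in>I. t < u" and y: "\<forall>u\<in>I. t < u \<longrightarrow> y \<le> v u"
  then obtain u where u: "u \<in> I" "t < u" by auto
  show "y \<le> v t"
    unfolding v_eq_Inf[OF t u]
  proof (rule cInf_greatest)
    fix z assume "z \<in> V ` ({t<..} \<inter> I)"
    then obtain x where x: "x \<in> I" "t < x" "z = V x" by auto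
    obtain m where m: "t < m" "m < x" using dense[OF x(2)] by auto
    then have "m \<in> I" using between[OF t x(1)] by simp
    then show "y \<le> z" using y m v_le_V[of m x] x by force
  qed (use u in auto)
qed

lemmas lebesgue_stieltjes_v = lebesgue_stieltjes_on[OF conn _ mono_v v_right_continuous]

text \<open>\<open>measure_of\<close> returns the given set function only if that is countably
  additive, which is checked for the Stieltjes part and the atom separately.\<close>

lemma sets_\<nu> [measurable_cong, simp]: "sets \<nu> = sets (borel_on I)"
  and emeasure_\<nu>: "A \<in> sets (borel_on I) \<Longrightarrow> emeasure \<nu> A = emeasure (lebesgue_stieltjes_on I v) A
       + (\<Sum>a | a \<in> I \<and> (\<forall>t\<in>I. a \<le> t). ennreal (v a - V a) * indicator A a)"
proof -
  let ?mn = "{a \<in> I. \<forall>t\<in>I. a \<le> t}"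
  let ?M = "sets (borel_on I)"
  let ?\<mu> = "\<lambda>A. emeasure (lebesgue_stieltjes_on I v) A + (\<Sum>a\<in>?mn. ennreal (v a - V a) * indicator A a)"
  have sp: "space (borel_on I) = I" by (simp add: space_restrict_space)
  have \<nu>: "\<nu> = measure_of I ?M ?\<mu>" by (simp add: speed_measure_def Let_def)
  have alg: "sigma_algebra I ?M" using sets.sigma_algebra_axioms[of "borel_on I"] unfolding sp .
  have sets: "sets (lebesgue_stieltjes_on I v) = ?M" using lebesgue_stieltjes_v(1) c_in by auto
  show "sets \<nu> = ?M"
    unfolding \<nu> using sigma_algebra.sets_measure_of_eq[OF alg] by simp
  have "countably_additive ?M ?\<mu>"
  proof (rule countably_additiveI)
    fix A :: "nat \<Rightarrow> real set"
    assume A: "range A \<subseteq> ?M" "disjoint_family A" "(\<Union>i. A i) \<in> ?M"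
    have "(\<Sum>i. ?\<mu> (A i)) = (\<Sum>i. emeasure (lebesgue_stieltjes_on I v) (A i))
       + (\<Sum>i. \<Sum>a\<in>?mn. ennreal (v a - V a) * indicator (A i) a)"
      by (rule suminf_add[symmetric]) auto
    also have "(\<Sum>i. emeasure (lebesgue_stieltjes_on I v) (A i)) = emeasure (lebesgue_stieltjes_on I v) (\<Union>i. A i)"
      using A sets by (intro suminf_emeasure) auto
    also have "(\<Sum>i. \<Sum>a\<in>?mn. ennreal (v a - V a) * indicator (A i) a)
        = (\<Sum>a\<in>?mn. \<Sum>i. ennreal (v a - V a) * indicator (A i) a)"
      by (rule suminf_sum) auto
    also have "\<dots> = (\<Sum>a\<in>?mn. ennreal (v a - V a) * indicator (\<Union>i. A i) a)"
      using suminf_indicator[OF A(2)] by simp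
    finally show "(\<Sum>i. ?\<mu> (A i)) = ?\<mu> (\<Union>i. A i)" .
  qed
  then show "emeasure \<nu> A = ?\<mu> A" if "A \<in> ?M" for A
    unfolding \<nu> using that by (intro emeasure_measure_of_sigma[OF alg]) (auto simp: positive_def)
qed

lemma sets_borel_onI: "A \<in> sets borel \<Longrightarrow> A \<subseteq> I \<Longrightarrow> A \<in> sets (borel_on I)"
  by (simp add: sets_restrict_space_iff)

lemma \<nu>_Ioc:
  assumes "s \<in> I" "t \<in> I" "s \<le> t"
  shows "emeasure \<nu> {s<..t} = ennreal (v t - v s)"
proof -
  have "{s<..t} \<in> sets (borel_on I)"
    using Ioc_subset[OF conn] assms by (intro sets_borel_onI) auto
  moreover have "(\<Sum>a | a \<in> I \<and> (\<forall>t\<in>I. a \<le> t). ennreal (v a - V a) * indicator {s<..t} a) = 0"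
    using assms by (intro sum.neutral) (auto simp: indicator_def)
  ultimately show ?thesis using lebesgue_stieltjes_v(2)[OF _ assms] c_in by (auto simp: emeasure_\<nu>)
qed

lemma \<nu>_min:
  assumes "a \<in> I" "\<forall>t\<in>I. a \<le> t"
  shows "emeasure \<nu> {a} = ennreal (v a - V a)"
proof -
  have "{a' \<in> I. \<forall>t\<in>I. a' \<le> t} = {a}" using assms by (auto intro: order_antisym)
  moreover have "{a} \<in> sets (borel_on I)"
    using assms by (intro sets_borel_onI) auto
  ultimately show ?thesis using lebesgue_stieltjes_v(3)[OF _ assms] c_in by (auto simp: emeasure_\<nu>)
qed

text \<open>If \<open>s\<close> is the minimum of \<open>I\<close>, the atom there raises the
  measure to exactly \<open>v t - V s\<close>. Otherwise \<open>{s..t}\<close> is the decreasing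
  limit of \<open>{x n<..t}\<close> with \<open>x n < s\<close>, and
  \<open>v (x n) \<le> V s\<close> while \<open>V t \<le> v t\<close>.\<close>

lemma V_diff_le_\<nu>_Icc:
  assumes st: "s \<in> I" "t \<in> I" "s \<le> t"
  shows "ennreal (V t - V s) \<le> emeasure \<nu> {s..t}"
proof (cases "\<forall>u\<in>I. s \<le> u")
  case True
  have "emeasure \<nu> {s..t} = emeasure \<nu> ({s} \<union> {s<..t})"
    using st by (intro arg_cong[where f="emeasure \<nu>"]) auto
  also have "\<dots> = emeasure \<nu> {s} + emeasure \<nu> {s<..t}"
    using st Ioc_subset[OF conn] by (intro plus_emeasure[symmetric]) (auto intro!: sets_borel_onI)
  also have "\<dots> = ennreal (v t - V s)"
    using st mono_onD[OF mono_v st] V_le_v[OF st(1)] True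
    by (simp add: \<nu>_Ioc \<nu>_min flip: ennreal_plus)
  finally show ?thesis using V_le_v[OF st(2)] by (simp add: ennreal_leI)
next
  case False
  then obtain l where l: "l \<in> I" "l < s" by (auto simp: not_le)
  obtain x :: "nat \<Rightarrow> real" where x: "\<And>n. l \<le> x n" "\<And>n. x n < s" "incseq x" "x \<longlonglongrightarrow> s"
    by (rule seq_to_left_endpoint[OF l(2)]) blast
  have xI: "x n \<in> I" for n using between[OF l(1) st(1), of "x n"] x(1,2)[of n] by simp
  have Icc: "{s..t} = (\<Inter>n. {x n<..t})"
  proof (intro equalityI subsetI)
    fix y assume "y \<in> (\<Inter>n. {x n<..t})"
    then have y: "x n < y" "y \<le> t" for n by auto
    then have "s \<le> y" using x(4) by (intro LIMSEQ_le_const2) (auto intro: less_imp_le)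
    then show "y \<in> {s..t}" using y by simp
  qed (use x(2) in \<open>auto intro: less_le_trans\<close>)
  have "ennreal (V t - V s) \<le> (INF n. emeasure \<nu> {x n<..t})"
  proof (rule INF_greatest)
    fix n
    have "V t - V s \<le> v t - v (x n)"
      using V_le_v[OF st(2)] v_le_V[OF xI st(1) x(2)[of n]] by simp
    then show "ennreal (V t - V s) \<le> emeasure \<nu> {x n<..t}"
      using \<nu>_Ioc[OF xI st(2), of n] x(2)[of n] st(3) by (simp add: ennreal_leI)
  qed
  also have "\<dots> = emeasure \<nu> (\<Inter>n. {x n<..t})"
  proof (rule INF_emeasure_decseq)
    show "range (\<lambda>n. {x n<..t}) \<subseteq> sets \<nu>"
      using Ioc_subset[OF conn xI st(2)] by (auto intro!: sets_borel_onI)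
    show "decseq (\<lambda>n. {x n<..t})" 
      by (auto simp: decseq_def intro: le_less_trans[OF incseqD[OF x(3)]])
    show "emeasure \<nu> {x n<..t} \<noteq> \<infinity>" for n
      using \<nu>_Ioc[OF xI st(2), of n] x(2)[of n] st(3) by simp
  qed
  finally show ?thesis unfolding Icc .
qed

text \<open>The open interval is the increasing union of \<open>{s<..x n}\<close> with
  \<open>x n < t\<close>; there \<open>v (x n) \<le> V t\<close> and
  \<open>V s \<le> v s\<close>.\<close>

lemma \<nu>_Ioo_le_V_diff:
  assumes st: "s \<in> I" "t \<in> I" "s \<le> t"
  shows "emeasure \<nu> {s<..<t} \<le> ennreal (V t - V s)"
proof (cases "s = t")
  case False
  then have "s < t" using st by simp
  obtain x :: "nat \<Rightarrow> real" where x: "\<And>n. s \<le> x n" "\<And>n. x n < t" "incseq x" "x \<longlonglongrightarrow> t"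
    by (rule seq_to_left_endpoint[OF \<open>s < t\<close>]) blast
  have xI: "x n \<in> I" for n using between[OF st(1,2), of "x n"] x(1,2)[of n] by simp
  have Ioo: "{s<..<t} = (\<Union>n. {s<..x n})"
  proof (intro equalityI subsetI)
    fix y assume y: "y \<in> {s<..<t}"
    then have "\<forall>\<^sub>F n in sequentially. y < x n" using x(4) by (intro order_tendstoD) auto
    then obtain n where "y < x n" by (auto simp: eventually_sequentially)
    then show "y \<in> (\<Union>n. {s<..x n})" using y by (auto intro: less_imp_le)
  qed (use x(2) in \<open>auto intro: le_less_trans\<close>)
  have "emeasure \<nu> (\<Union>n. {s<..x n}) = (SUP n. emeasure \<nu> {s<..x n})"
  proof (rule SUP_emeasure_incseq[symmetric])
    show "range (\<lambda>n. {s<..x n}) \<subseteq> sets \<nu>"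
      using Ioc_subset[OF conn st(1) xI] by (auto intro!: sets_borel_onI)
    show "incseq (\<lambda>n. {s<..x n})" 
      using incseqD[OF x(3)] by (force simp: incseq_def intro: order_trans)
  qed
  also have "\<dots> \<le> ennreal (V t - V s)"
  proof (rule SUP_least)
    fix n
    have "v (x n) - v s \<le> V t - V s"
      using v_le_V[OF xI st(2) x(2)[of n]] V_le_v[OF st(1)] by simp
    then show "emeasure \<nu> {s<..x n} \<le> ennreal (V t - V s)"
      using \<nu>_Ioc[OF st(1) xI, of n] x(1)[of n] by (simp add: ennreal_leI)
  qed
  finally show ?thesis unfolding Ioo .
qed simp

end

text \<open>Lower semicontinuity of the variation: each chord sum of \<open>\<gamma>\<close> is the
  limit of chord sums over partitions moved by the monotone maps \<open>cl s\<close>.\<close>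

lemma variation_le_of_clamp:
  assumes F: "F \<noteq> bot" and lim: "\<And>x. x \<in> J \<Longrightarrow> ((\<lambda>s. \<gamma> (cl s x)) \<longlongrightarrow> \<gamma> x) F"
    and ev: "\<forall>\<^sub>F s in F. mono_on J (cl s) \<and> variation \<gamma> (cl s ` J) \<le> B"
  shows "variation \<gamma> J \<le> B"
proof (rule variation_leI)
  fix n and w :: "nat \<Rightarrow> real" assume w: "mono_on {..n} w" "w ` {..n} \<subseteq> J"
  let ?S = "\<lambda>u. \<Sum>k<n. dist (\<gamma> (u (w k))) (\<gamma> (u (w (Suc k))))"
  have "((\<lambda>s. ennreal (?S (cl s))) \<longlongrightarrow> ennreal (?S (\<lambda>x. x))) F"
    using w(2) by (intro tendsto_ennrealI tendsto_sum tendsto_dist lim) auto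
  moreover have "\<forall>\<^sub>F s in F. ennreal (?S (cl s)) \<le> B"
    using ev
  proof eventually_elim
    case (elim s)
    then have "mono_on {..n} (\<lambda>k. cl s (w k))" "(\<lambda>k. cl s (w k)) ` {..n} \<subseteq> cl s ` J"
      using w by (auto intro!: mono_onI mono_onD[of J "cl s"] mono_onD[of "{..n}" w])
    from variation_sum_le[OF this, of \<gamma>] elim show ?case by (auto intro: order_trans)
  qed
  ultimately show "ennreal (\<Sum>k<n. dist (\<gamma> (w k)) (\<gamma> (w (Suc k)))) \<le> B"
    using F by (intro tendsto_upperbound)
qed

section \<open>Atoms of the speed measure and the variation over intervals\<close>

context bv_path
begin

text \<open>Suppose that \<open>V\<close> jumped by \<open>\<epsilon> > 0\<close> to the right of
  \<open>p\<close>. Moving partition points below \<open>s\<close> up to \<open>s\<close> leaves at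
  most the variation over \<open>{s..b}\<close>, which is smaller by \<open>\<epsilon>\<close>; but
  as \<open>s\<close> tends to \<open>p\<close>, continuity of \<open>\<gamma>\<close> makes the
  loss in each chord sum vanish.\<close>

lemma V_right_continuous:
  assumes p: "p \<in> I" "b \<in> I" "p < b" and cont: "continuous (at p within I) \<gamma>"
    and \<epsilon>: "\<And>s. p < s \<Longrightarrow> s < b \<Longrightarrow> \<epsilon> \<le> V s - V p"
  shows "\<epsilon> \<le> 0"
proof (rule ccontr)
  assume "\<not> \<epsilon> \<le> 0"
  have sub: "{p..b} \<subseteq> I" using between[OF p(1,2)] by auto
  have lim_p: "(\<gamma> \<longlongrightarrow> \<gamma> p) (at_right p)"
    using cont tendsto_within_subset[OF _ sub] p(3)
    unfolding continuous_within by (simp flip: at_within_Icc_at_right)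
  have "variation \<gamma> {p..b} \<le> ennreal (V b - V p - \<epsilon>)"
  proof (rule variation_le_of_clamp[where cl="\<lambda>s x. max x s" and F="at_right p"])
    fix x assume x: "x \<in> {p..b}"
    show "((\<lambda>s. \<gamma> (max x s)) \<longlongrightarrow> \<gamma> x) (at_right p)"
    proof (cases "x = p")
      case True
      have "\<forall>\<^sub>F s in at_right p. \<gamma> (max x s) = \<gamma> s"
        using eventually_at_right_less[of p] by eventually_elim (simp add: True)
      then show ?thesis using lim_p True by (simp add: tendsto_cong)
    next
      case False
      then have "\<forall>\<^sub>F s in at_right p. s \<in> {p<..<x}" using x by (intro eventually_at_right_real) auto
      then have "\<forall>\<^sub>F s in at_right p. \<gamma> (max x s) = \<gamma> x" by eventually_elim auto
      then show ?thesis by (rule tendsto_eventually)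
    qed
  next
    have "\<forall>\<^sub>F s in at_right p. s \<in> {p<..<b}" using p by (intro eventually_at_right_real)
    then show "\<forall>\<^sub>F s in at_right p. mono_on {p..b} (\<lambda>x. max x s) \<and>
        variation \<gamma> ((\<lambda>x. max x s) ` {p..b}) \<le> ennreal (V b - V p - \<epsilon>)"
    proof eventually_elim
      case (elim s)
      then have "variation \<gamma> ((\<lambda>x. max x s) ` {p..b}) \<le> variation \<gamma> {s..b}"
        by (intro variation_mono) auto
      also have "\<dots> = ennreal (V b - V s)" using elim p sub by (intro variation_eq_V) auto
      also have "\<dots> \<le> ennreal (V b - V p - \<epsilon>)" using \<epsilon>[of s] elim by (intro ennreal_leI) auto
      finally show ?case by (auto intro!: mono_onI)
    qed
  qed simp
  \<comment> \<open>Any such \<open>s\<close> shows that the bound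
    \<open>V b - V p - \<epsilon>\<close> is nonnegative, without which \<open>ennreal\<close> would
    truncate it.\<close>
  moreover obtain s where s: "p < s" "s < b" using dense[OF p(3)] by auto
  then have "V s \<le> V b" using sub p by (intro V_le) auto
  then have "0 \<le> V b - V p - \<epsilon>" using \<epsilon>[OF s] by simp
  ultimately show False
    using variation_eq_V[OF p(1,2)] p(3) \<open>\<not> \<epsilon> \<le> 0\<close> by (simp add: ennreal_le_iff)
qed

text \<open>Mirror image of \<open>V_right_continuous\<close>: points above \<open>s\<close> are
  moved down by \<open>min x s\<close>.\<close>

lemma V_left_continuous:
  assumes p: "p \<in> I" "a \<in> I" "a < p" and cont: "continuous (at p within I) \<gamma>"
    and \<epsilon>: "\<And>s. a < s \<Longrightarrow> s < p \<Longrightarrow> \<epsilon> \<le> V p - V s"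
  shows "\<epsilon> \<le> 0"
proof (rule ccontr)
  assume "\<not> \<epsilon> \<le> 0"
  have sub: "{a..p} \<subseteq> I" using between[OF p(2,1)] by auto
  have lim_p: "(\<gamma> \<longlongrightarrow> \<gamma> p) (at_left p)"
    using cont tendsto_within_subset[OF _ sub] p(3)
    unfolding continuous_within by (simp flip: at_within_Icc_at_left)
  have "variation \<gamma> {a..p} \<le> ennreal (V p - V a - \<epsilon>)"
  proof (rule variation_le_of_clamp[where cl="\<lambda>s x. min x s" and F="at_left p"])
    fix x assume x: "x \<in> {a..p}"
    show "((\<lambda>s. \<gamma> (min x s)) \<longlongrightarrow> \<gamma> x) (at_left p)"
    proof (cases "x = p")
      case True
      have "\<forall>\<^sub>F s in at_left p. s \<in> {a<..<p}" using p by (intro eventually_at_left_real)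
      then have "\<forall>\<^sub>F s in at_left p. \<gamma> (min x s) = \<gamma> s"
        by eventually_elim (simp add: True)
      then show ?thesis using lim_p True by (simp add: tendsto_cong)
    next
      case False
      then have "\<forall>\<^sub>F s in at_left p. s \<in> {x<..<p}" using x by (intro eventually_at_left_real) auto
      then have "\<forall>\<^sub>F s in at_left p. \<gamma> (min x s) = \<gamma> x" by eventually_elim auto
      then show ?thesis by (rule tendsto_eventually)
    qed
  next
    have "\<forall>\<^sub>F s in at_left p. s \<in> {a<..<p}" using p by (intro eventually_at_left_real)
    then show "\<forall>\<^sub>F s in at_left p. mono_on {a..p} (\<lambda>x. min x s) \<and>
        variation \<gamma> ((\<lambda>x. min x s) ` {a..p}) \<le> ennreal (V p - V a - \<epsilon>)"
    proof eventually_elim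
      case (elim s)
      then have "variation \<gamma> ((\<lambda>x. min x s) ` {a..p}) \<le> variation \<gamma> {a..s}"
        by (intro variation_mono) auto
      also have "\<dots> = ennreal (V s - V a)" using elim p sub by (intro variation_eq_V) auto
      also have "\<dots> \<le> ennreal (V p - V a - \<epsilon>)" using \<epsilon>[of s] elim by (intro ennreal_leI) auto
      finally show ?case by (auto intro!: mono_onI)
    qed
  qed simp
  moreover obtain s where s: "a < s" "s < p" using dense[OF p(3)] by auto
  then have "V a \<le> V s" using sub p by (intro V_le) auto
  then have "0 \<le> V p - V a - \<epsilon>" using \<epsilon>[OF s] by simp
  ultimately show False
    using variation_eq_V[OF p(2,1)] p(3) \<open>\<not> \<epsilon> \<le> 0\<close> by (simp add: ennreal_le_iff)
qed

text \<open>An atom consists of a left and a right jump of \<open>V\<close>, and continuity of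
  \<open>\<gamma>\<close> excludes both. At the minimum of \<open>I\<close> only the right jump
  \<open>v p - V p\<close> is present.\<close>

lemma \<nu>_singleton_eq_0:
  assumes p: "p \<in> I" and cont: "continuous (at p within I) \<gamma>"
  shows "emeasure \<nu> {p} = 0"
proof -
  have mono: "emeasure \<nu> {p} \<le> emeasure \<nu> A" if "p \<in> A" "A \<in> sets borel" "A \<subseteq> I" for A
    using that by (intro emeasure_mono) (auto intro!: sets_borel_onI)
  show ?thesis
  proof (cases "\<forall>t\<in>I. p \<le> t")
    case True
    have "v p - V p \<le> 0"
    proof (cases "\<forall>t\<in>I. t \<le> p")
      case True
      then show ?thesis by (simp add: v_max)
    next
      case False
      then obtain b where b: "b \<in> I" "p < b" by (auto simp: not_le)
      show ?thesis
        using v_le_V[OF p] between[OF p b(1)]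
        by (intro V_right_continuous[OF p b cont]) auto
    qed
    then show ?thesis using \<nu>_min[OF p True] by (simp add: ennreal_neg)
  next
    case False
    then obtain a where a: "a \<in> I" "a < p" by (auto simp: not_le)
    have "emeasure \<nu> {p} \<le> emeasure \<nu> {a<..p}"
      using a Ioc_subset[OF conn a(1) p] by (intro mono) auto
    also have "\<dots> < \<infinity>" using a p by (simp add: \<nu>_Ioc)
    finally obtain e where e: "0 \<le> e" "emeasure \<nu> {p} = ennreal e"
      by (cases "emeasure \<nu> {p}") auto
    \<comment> \<open>The right jump is removed first: the mass \<open>e\<close> is at most
      \<open>V s - V l\<close> for all \<open>s\<close> right of \<open>p\<close>, and
      \<open>s\<close> tends to \<open>p\<close>. At the maximum of \<open>I\<close>,
      \<open>v p = V p\<close> does the same. Left continuity then finishes.\<close>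
    have "e \<le> V p - V l" if l: "l \<in> I" "l < p" for l
    proof (cases "\<forall>t\<in>I. t \<le> p")
      case True
      have "ennreal e \<le> emeasure \<nu> {l<..p}"
        using l Ioc_subset[OF conn l(1) p] unfolding e(2)[symmetric] by (intro mono) auto
      also have "\<dots> = ennreal (v p - v l)" using l p by (simp add: \<nu>_Ioc)
      also have "\<dots> \<le> ennreal (V p - V l)"
        using v_max[OF True] V_le_v[OF l(1)] by (intro ennreal_leI) auto
      finally show ?thesis using V_le[OF l(1) p] l by (simp add: ennreal_le_iff)
    next
      case False
      then obtain b where b: "b \<in> I" "p < b" by (auto simp: not_le)
      have "e - (V p - V l) \<le> V s - V p" if s: "p < s" "s < b" for s
      proof -
        have sI: "s \<in> I" using between[OF p b(1)] s by simp
        have "ennreal e \<le> emeasure \<nu> {l<..<s}"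
          using l s between[OF l(1) sI] unfolding e(2)[symmetric] by (intro mono) auto
        also have "\<dots> \<le> ennreal (V s - V l)" using l s sI by (intro \<nu>_Ioo_le_V_diff) auto
        finally show ?thesis using V_le[OF l(1) sI] l s by (simp add: ennreal_le_iff)
      qed
      from V_right_continuous[OF p b cont this] show ?thesis by simp
    qed
    then have "e \<le> 0"
      using between[OF a(1) p] by (intro V_left_continuous[OF p a cont]) auto
    then show ?thesis using e by simp
  qed
qed

lemma variation_le_\<nu>:
  assumes J: "connected J" "J \<subseteq> I"
  shows "variation \<gamma> J \<le> emeasure \<nu> J"
proof (rule variation_leI)
  fix n and w :: "nat \<Rightarrow> real" assume w: "mono_on {..n} w" "w ` {..n} \<subseteq> J"
  have wJ: "w k \<in> J" if "k \<le> n" for k using w(2) that by auto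
  have "(\<Sum>k<n. dist (\<gamma> (w k)) (\<gamma> (w (Suc k)))) \<le> (\<Sum>k<n. V (w (Suc k)) - V (w k))"
    using J(2) wJ by (intro sum_mono dist_le_V mono_onD[OF w(1)]) (auto intro!: subsetD[OF J(2)])
  also have "\<dots> = V (w n) - V (w 0)" by (rule sum_lessThan_telescope)
  finally have "ennreal (\<Sum>k<n. dist (\<gamma> (w k)) (\<gamma> (w (Suc k)))) \<le> ennreal (V (w n) - V (w 0))"
    by (rule ennreal_leI)
  also have "\<dots> \<le> emeasure \<nu> {w 0..w n}"
    using J(2) wJ by (intro V_diff_le_\<nu>_Icc mono_onD[OF w(1)]) auto
  also have "\<dots> \<le> emeasure \<nu> J"
    using connectedD_interval[OF J(1) wJ wJ, of 0 n] J borel_connected[OF J(1)]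
    by (intro emeasure_mono) (auto intro!: sets_borel_onI)
  finally show "ennreal (\<Sum>k<n. dist (\<gamma> (w k)) (\<gamma> (w (Suc k)))) \<le> emeasure \<nu> J" .
qed

text \<open>Open intervals \<open>{a n<..<b n}\<close> with endpoints in \<open>U\<close> increase
  to \<open>U\<close>, and the mass of each is at most \<open>V (b n) - V (a n)\<close>, the
  variation over a closed subinterval of \<open>U\<close>. The endpoints are running minima and
  maxima of an enumerated cofinal set.\<close>

lemma \<nu>_open_le_variation:
  assumes U: "connected U" "open U" "U \<subseteq> I"
  shows "emeasure \<nu> U \<le> variation \<gamma> U"
proof (cases "U = {}")
  case False
  obtain C where C: "countable C" "C \<subseteq> U"
    "\<forall>x\<in>U. (\<exists>t\<in>C. x \<le> t) \<and> ((\<exists>s\<in>C. s < x) \<or> (\<forall>y\<in>U. x \<le> y))"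
    by (rule interval_countable_cofinal[OF U(1)])
  have "C \<noteq> {}" using C(3) False by auto
  define e where "e = from_nat_into C"
  have range_e: "range e = C" using C(1) \<open>C \<noteq> {}\<close> by (simp add: e_def range_from_nat_into)
  then have eU: "e n \<in> U" for n using C(2) by auto
  define a where "a n = Min (e ` {..n})" for n
  define b where "b n = Max (e ` {..n})" for n
  have "a n \<in> e ` {..n}" "b n \<in> e ` {..n}" for n
    unfolding a_def b_def by (intro Min_in Max_in; simp)+
  moreover have "e ` {..n} \<subseteq> U" for n using eU by blast
  ultimately have abU: "a n \<in> U" "b n \<in> U" for n by blast+
  have ab: "a n \<le> e i" "e i \<le> b n" if "i \<le> n" for n i
    using that unfolding a_def b_def by auto
  have "U = (\<Union>n. {a n<..<b n})"
  proof (intro equalityI subsetI)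
    fix x assume x: "x \<in> U"
    \<comment> \<open>Cofinality bounds a point only weakly from above, so it is applied to
      \<open>x + d\<close> to get an endpoint strictly beyond \<open>x\<close>; \<open>x - d\<close>
      shows that \<open>x\<close> is not the minimum.\<close>
    obtain d where d: "d > 0" "cball x d \<subseteq> U" using U(2) x open_contains_cball by blast
    then have "x + d \<in> U" "x - d \<in> U" by (auto simp: cball_eq_atLeastAtMost)
    then obtain s t where "s \<in> C" "s < x" "t \<in> C" "x + d \<le> t"
      using C(3) x d(1) by (metis diff_ge_0_iff_ge diff_gt_0_iff_gt le_diff_eq not_le less_add_same_cancel1 diff_less_eq)
    then obtain i j where "e i < x" "x < e j" using range_e d(1) by (metis imageE less_add_same_cancel1 less_le_trans)
    then have "x \<in> {a (max i j)<..<b (max i j)}"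
      using ab(1)[of i "max i j"] ab(2)[of j "max i j"] by auto
    then show "x \<in> (\<Union>n. {a n<..<b n})" by blast
  next
    fix x assume "x \<in> (\<Union>n. {a n<..<b n})"
    then obtain n where "a n < x" "x < b n" by auto
    then show "x \<in> U" using connectedD_interval[OF U(1) abU(1) abU(2), of n x n] by simp
  qed
  moreover have "emeasure \<nu> (\<Union>n. {a n<..<b n}) = (SUP n. emeasure \<nu> {a n<..<b n})"
  proof (rule SUP_emeasure_incseq[symmetric])
    show "range (\<lambda>n. {a n<..<b n}) \<subseteq> sets \<nu>"
      using calculation U(3) by (auto intro!: sets_borel_onI)
    have "a n \<le> a m" "b m \<le> b n" if "m \<le> n" for m n
      using that unfolding a_def b_def by (auto intro!: Min_antimono Max_mono)
    then show "incseq (\<lambda>n. {a n<..<b n})" by (force simp: incseq_def)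
  qed
  moreover have "emeasure \<nu> {a n<..<b n} \<le> variation \<gamma> U" for n
  proof -
    have le: "a n \<le> b n" using ab[of 0 n] by simp
    have I: "a n \<in> I" "b n \<in> I" using abU U(3) by auto
    have "emeasure \<nu> {a n<..<b n} \<le> variation \<gamma> {a n..b n}"
      using \<nu>_Ioo_le_V_diff[OF I le] variation_eq_V[OF I le] by simp
    also have "\<dots> \<le> variation \<gamma> U"
      using connectedD_interval[OF U(1) abU] by (intro variation_mono) auto
    finally show ?thesis .
  qed
  ultimately show ?thesis by (auto intro: SUP_least)
qed simp

text \<open>A point of \<open>J\<close> outside its interior is the minimum or maximum of
  \<open>J\<close>; there \<open>\<gamma>\<close> is continuous, so it carries no mass. Thus
  \<open>J\<close> has the measure of its interior, for which the open case applies.\<close>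

lemma variation_eq_\<nu>:
  assumes J: "connected J" "J \<subseteq> I" and cont: "J - interior J \<subseteq> I - discontinuities I \<gamma>"
  shows "variation \<gamma> J = emeasure \<nu> J"
proof (rule antisym)
  let ?E = "J - interior J"
  have "p \<in> {x\<in>J. \<forall>y\<in>J. x \<le> y} \<union> {x\<in>J. \<forall>y\<in>J. y \<le> x}" if p: "p \<in> ?E" for p
  proof (rule ccontr)
    assume "\<not> ?thesis"
    then obtain l u where "l \<in> J" "u \<in> J" "l < p" "p < u" using p by (auto simp: not_le)
    moreover from this have "{l<..<u} \<subseteq> J" using connectedD_interval[OF J(1), of l u] by auto
    ultimately show False using p interiorI[of "{l<..<u}" p J] by auto
  qed
  moreover have "finite ({x\<in>J. \<forall>y\<in>J. x \<le> y} \<union> {x\<in>J. \<forall>y\<in>J. y \<le> x})"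
    by (intro finite_UnI finite_if_unique) (auto intro: order_antisym)
  ultimately have "finite ?E" by (meson finite_subset subsetI)
  moreover have "{p} \<in> null_sets \<nu>" if "p \<in> ?E" for p
    using that cont J \<nu>_singleton_eq_0[of p]
    by (intro null_setsI) (auto simp: discontinuities_def intro!: sets_borel_onI)
  ultimately have "(\<Union>p\<in>?E. {p}) \<in> null_sets \<nu>"
    by (intro null_sets_UN') (auto simp: countable_finite)
  then have null: "?E \<in> null_sets \<nu>" by simp
  have int: "connected (interior J)" "interior J \<subseteq> I"
    using J interior_subset[of J] convex_interior[of J] by (auto simp: convex_connected is_interval_convex_1 simp flip: is_interval_connected_1)
  have "emeasure \<nu> J = emeasure \<nu> (interior J \<union> ?E)"
    using interior_subset[of J] by (intro arg_cong[where f="emeasure \<nu>"]) auto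
  also have "\<dots> = emeasure \<nu> (interior J)"
    using int null by (intro emeasure_Un_null_set) (auto intro!: sets_borel_onI)
  also have "\<dots> \<le> variation \<gamma> (interior J)" using int by (intro \<nu>_open_le_variation) auto
  also have "\<dots> \<le> variation \<gamma> J" by (intro variation_mono interior_subset)
  finally show "emeasure \<nu> J \<le> variation \<gamma> J" .
qed (rule variation_le_\<nu>[OF J])

end

section \<open>Density of the speed measure\<close>

context bv_path
begin

lemma \<nu>_Icc_finite:
  assumes ab: "a \<in> I" "b \<in> I"
  shows "emeasure \<nu> {a..b} < \<infinity>"
proof (cases "a \<le> b")
  case le: True
  show ?thesis
  proof (cases "\<forall>t\<in>I. a \<le> t")
    case True
    have "emeasure \<nu> {a..b} = emeasure \<nu> ({a} \<union> {a<..b})"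
      using le by (intro arg_cong[where f="emeasure \<nu>"]) auto
    also have "\<dots> \<le> emeasure \<nu> {a} + emeasure \<nu> {a<..b}"
      using ab Ioc_subset[OF conn ab] by (intro emeasure_subadditive) (auto intro!: sets_borel_onI)
    also have "\<dots> < \<infinity>" using \<nu>_Ioc[OF ab le] \<nu>_min[OF ab(1) True] by simp
    finally show ?thesis .
  next
    case False
    then obtain l where l: "l \<in> I" "l < a" by (auto simp: not_le)
    have "emeasure \<nu> {a..b} \<le> emeasure \<nu> {l<..b}"
      using l Ioc_subset[OF conn l(1) ab(2)] by (intro emeasure_mono) (auto intro!: sets_borel_onI)
    also have "\<dots> < \<infinity>" using \<nu>_Ioc[OF l(1) ab(2)] l le by simp
    finally show ?thesis .
  qed
qed simp

end

locale bv_decomposition = bv_path +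
  fixes \<nu>_ac \<nu>_sing :: "real measure"
  assumes decomp: "lebesgue_decomposition (lborel_on I) \<nu> \<nu>_ac \<nu>_sing"
begin

lemma sets_lborel_on: "sets (lborel_on I) = sets (borel_on I)"
  by (rule sets_restrict_space_cong) simp

lemma sets_borel_on_iff: "A \<in> sets (borel_on I) \<longleftrightarrow> A \<subseteq> I \<and> A \<in> sets borel"
  by (subst sets_restrict_space_iff) auto

lemma emeasure_lborel_on: "A \<subseteq> I \<Longrightarrow> emeasure (lborel_on I) A = emeasure lborel A"
  by (rule emeasure_restrict_space) auto

lemma sets_ac: "sets \<nu>_ac = sets (borel_on I)"
  and sets_sing: "sets \<nu>_sing = sets (borel_on I)"
  and \<nu>_split: "A \<in> sets (borel_on I) \<Longrightarrow> emeasure \<nu> A = emeasure \<nu>_ac A + emeasure \<nu>_sing A"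
  and abs_cont: "absolutely_continuous (lborel_on I) \<nu>_ac"
  using decomp unfolding lebesgue_decomposition_def sets_lborel_on by auto

text \<open>A Lebesgue-null set that carries all of \<open>\<nu>_sing\<close>.\<close>

definition sing_set where
  "sing_set = (SOME A. A \<in> sets (borel_on I) \<and> emeasure lborel A = 0 \<and> emeasure \<nu>_sing (I - A) = 0)"

lemma sing_set: "sing_set \<in> sets (borel_on I)" "emeasure lborel sing_set = 0" "emeasure \<nu>_sing (I - sing_set) = 0"
proof -
  have "space \<nu>_sing = I" using sets_eq_imp_space_eq[OF sets_sing] by (simp add: space_restrict_space)
  moreover have "mutually_singular (lborel_on I) \<nu>_sing"
    using decomp unfolding lebesgue_decomposition_def by blast
  ultimately obtain A where A: "A \<in> sets (borel_on I)" "emeasure (lborel_on I) A = 0" "emeasure \<nu>_sing (I - A) = 0"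
    unfolding mutually_singular_def sets_lborel_on space_restrict_space by auto
  then have "emeasure lborel A = 0" by (simp add: emeasure_lborel_on sets_borel_on_iff)
  with A have "\<exists>A. A \<in> sets (borel_on I) \<and> emeasure lborel A = 0 \<and> emeasure \<nu>_sing (I - A) = 0"
    by blast
  from someI_ex[OF this] show "sing_set \<in> sets (borel_on I)" "emeasure lborel sing_set = 0" "emeasure \<nu>_sing (I - sing_set) = 0"
    unfolding sing_set_def by auto
qed

text \<open>A version of the Radon-Nikodym density, with values in \<open>ennreal\<close>; it may be
  infinite on a null set.\<close>

definition f where "f = (SOME f. f \<in> borel_measurable (lborel_on I) \<and> density (lborel_on I) f = \<nu>_ac)"

lemma measurable_f [measurable]: "f \<in> borel_measurable (lborel_on I)"
  and density_f: "density (lborel_on I) f = \<nu>_ac"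
proof -
  interpret sigma_finite_measure "lborel_on I"
    by (rule sigma_finite_measure_restrict_space) (auto intro: sigma_finite_lborel)
  have "\<exists>f. f \<in> borel_measurable (lborel_on I) \<and> density (lborel_on I) f = \<nu>_ac"
    using Radon_Nikodym[OF abs_cont] sets_ac sets_lborel_on by auto
  from someI_ex[OF this] show "f \<in> borel_measurable (lborel_on I)" "density (lborel_on I) f = \<nu>_ac"
    unfolding f_def by auto
qed

lemma \<nu>_ac_eq: "A \<in> sets (borel_on I) \<Longrightarrow> emeasure \<nu>_ac A = (\<integral>\<^sup>+t\<in>A. f t \<partial>lborel_on I)"
  by (subst density_f[symmetric], subst emeasure_density) (auto simp: sets_lborel_on)

lemma level_sets: "{t \<in> I. f t \<le> x} \<in> sets (borel_on I)" "{t \<in> I. x \<le> f t} \<in> sets (borel_on I)"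
proof -
  have "{t \<in> space (lborel_on I). f t \<le> x} \<in> sets (lborel_on I)" "{t \<in> space (lborel_on I). x \<le> f t} \<in> sets (lborel_on I)"
    by measurable
  then show "{t \<in> I. f t \<le> x} \<in> sets (borel_on I)" "{t \<in> I. x \<le> f t} \<in> sets (borel_on I)"
    by (simp_all add: space_restrict_space sets_lborel_on)
qed

lemma \<nu>_ac_le:
  assumes "A \<in> sets (borel_on I)" "\<And>t. t \<in> A \<Longrightarrow> f t \<le> x"
  shows "emeasure \<nu>_ac A \<le> x * emeasure lborel A"
proof -
  have "emeasure \<nu>_ac A \<le> (\<integral>\<^sup>+t\<in>A. x \<partial>lborel_on I)"
    unfolding \<nu>_ac_eq[OF assms(1)]
    by (intro nn_integral_mono) (auto simp: indicator_def assms(2))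
  also have "\<dots> = x * emeasure (lborel_on I) A"
    using assms(1) by (subst nn_integral_cmult_indicator) (auto simp: sets_lborel_on)
  finally show ?thesis using assms(1) by (simp add: emeasure_lborel_on sets_borel_on_iff)
qed

lemma \<nu>_ac_ge:
  assumes "A \<in> sets (borel_on I)" "\<And>t. t \<in> A \<Longrightarrow> x \<le> f t"
  shows "x * emeasure lborel A \<le> emeasure \<nu>_ac A"
proof -
  have "x * emeasure (lborel_on I) A = (\<integral>\<^sup>+t\<in>A. x \<partial>lborel_on I)"
    using assms(1) by (subst nn_integral_cmult_indicator) (auto simp: sets_lborel_on)
  also have "\<dots> \<le> emeasure \<nu>_ac A"
    unfolding \<nu>_ac_eq[OF assms(1)]
    by (intro nn_integral_mono) (auto simp: indicator_def assms(2))
  finally show ?thesis using assms(1) by (simp add: emeasure_lborel_on sets_borel_on_iff)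
qed

text \<open>Localizes \<open>AE_density_of_complement\<close> to measures on \<open>I\<close> that
  are finite only on the window. It is applied to \<open>\<nu>\<close> for the upper and to Lebesgue
  measure for the lower density bound.\<close>

lemma AE_restricted_complement:
  assumes ab: "a \<in> I" "b \<in> I" and N: "sets N = sets (borel_on I)" "emeasure N {a..b} < \<infinity>"
    and E: "E \<in> sets borel" and "0 < \<alpha>"
  shows "AE t in lborel. t \<in> E \<longrightarrow> a < t \<and> t < b \<longrightarrow>
    (\<exists>\<delta>>0. \<forall>r. 0 < r \<and> r < \<delta> \<longrightarrow> {t - r..t + r} \<subseteq> {a..b} \<and> measure N ({t - r..t + r} - E) \<le> \<alpha> * r)"
proof -
  have sub: "{a..b} \<subseteq> I" using between[OF ab] by auto
  have Nset: "A \<in> sets N" if "A \<subseteq> I" "A \<in> sets borel" for A using that N by (simp add: sets_borel_on_iff)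
  have spN: "space N = I" using sets_eq_imp_space_eq[OF N(1)] by (simp add: space_restrict_space)
  \<comment> \<open>The restriction of \<open>N\<close> to the window, regarded as a finite measure
    on the whole line.\<close>
  define M where "M = distr (restrict_space N {a..b}) borel (\<lambda>x. x)"
  have meas: "(\<lambda>x. x) \<in> restrict_space N {a..b} \<rightarrow>\<^sub>M borel"
  proof (rule measurable_restrict_space1)
    have "(\<lambda>x. x) \<in> borel_on I \<rightarrow>\<^sub>M borel" by (intro measurable_restrict_space1) simp
    then show "(\<lambda>x. x) \<in> N \<rightarrow>\<^sub>M borel" using N(1) by (simp cong: measurable_cong_sets)
  qed
  have M: "emeasure M B = emeasure N (B \<inter> {a..b})" if "B \<in> sets borel" for B
    unfolding M_def using that sub spN Nset[OF sub]
    by (subst emeasure_distr[OF meas]) (auto simp: emeasure_restrict_space space_restrict_space Int_absorb2)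
  have "finite_measure M"
    by (rule finite_measureI) (use N(2) M[of UNIV] in \<open>auto simp: M_def\<close>)
  moreover have "sets M = sets borel" by (simp add: M_def)
  ultimately have "AE t in lborel. t \<in> E \<longrightarrow> (\<exists>\<delta>>0. \<forall>r. 0 < r \<and> r < \<delta> \<longrightarrow> measure M (cball t r - E) \<le> \<alpha> * r)"
    using E \<open>0 < \<alpha>\<close> by (rule AE_density_of_complement)
  then show ?thesis
  proof eventually_elim
    case (elim t)
    show ?case
    proof (intro impI)
      assume t: "t \<in> E" "a < t \<and> t < b"
      with elim obtain \<delta> where \<delta>: "\<delta> > 0" "\<And>r. 0 < r \<Longrightarrow> r < \<delta> \<Longrightarrow> measure M (cball t r - E) \<le> \<alpha> * r" by blast
      show "\<exists>\<delta>>0. \<forall>r. 0 < r \<and> r < \<delta> \<longrightarrow> {t - r..t + r} \<subseteq> {a..b} \<and> measure N ({t - r..t + r} - E) \<le> \<alpha> * r"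
      proof (intro exI[of _ "min \<delta> (min (t - a) (b - t))"] conjI allI impI)
        fix r assume r: "0 < r \<and> r < min \<delta> (min (t - a) (b - t))"
        then show *: "{t - r..t + r} \<subseteq> {a..b}" by auto
        then have "({t - r..t + r} - E) \<inter> {a..b} = {t - r..t + r} - E" by blast
        moreover have "cball t r = {t - r..t + r}" by (rule cball_eq_atLeastAtMost)
        ultimately have "measure M (cball t r - E) = measure N ({t - r..t + r} - E)"
          using M[of "cball t r - E"] E by (simp add: measure_def)
        then show "measure N ({t - r..t + r} - E) \<le> \<alpha> * r" using \<delta>(2)[of r] r by simp
      qed (use \<delta>(1) t in auto)
    qed
  qed
qed

lemma AE_upper_density:
  assumes ab: "a \<in> I" "b \<in> I" and "0 \<le> q" "0 < \<eta>"
  shows "AE t in lborel. a < t \<and> t < b \<longrightarrow> f t \<le> ennreal q \<longrightarrow>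
    (\<exists>\<delta>>0. \<forall>r. 0 < r \<and> r < \<delta> \<longrightarrow> {t - r..t + r} \<subseteq> I \<and>
      V (t + r) - V t \<le> (q + \<eta>) * r \<and> V t - V (t - r) \<le> (q + \<eta>) * r)"
proof -
  define E where "E = {t \<in> I. f t \<le> ennreal q} - sing_set"
  have E: "E \<in> sets (borel_on I)" unfolding E_def using level_sets sing_set(1) by (intro sets.Diff) auto
  have sub: "{a..b} \<subseteq> I" using between[OF ab] by auto
  \<comment> \<open>\<open>T\<close> will be the centred interval \<open>{t - r..t + r}\<close> and
    \<open>{x..y}\<close> one of its halves: the error is controlled on centred balls only, while
    one-sided increments of \<open>V\<close> are wanted.\<close>
  have *: "V y - V x \<le> q * (y - x) + measure \<nu> (T - E)"
    if xy: "x \<le> y" "{x..y} \<subseteq> T" and T: "T \<subseteq> {a..b}" "T \<in> sets borel" for x y T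
  proof -
    have "x \<in> {x..y}" "y \<in> {x..y}" using xy(1) by auto
    then have xyI: "x \<in> I" "y \<in> I" using xy(2) T(1) sub by blast+
    have xyS: "{x..y} \<in> sets (borel_on I)" and TS: "T \<in> sets (borel_on I)" 
      using order_trans[OF xy(2) order_trans[OF T(1) sub]] order_trans[OF T(1) sub] T(2)
      by (auto simp: sets_borel_on_iff)
    have fin: "emeasure \<nu> (T - E) < \<infinity>"
    proof -
      have "emeasure \<nu> (T - E) \<le> emeasure \<nu> {a..b}"
        using T sub by (intro emeasure_mono) (auto simp: sets_borel_on_iff)
      then show ?thesis using \<nu>_Icc_finite[OF ab] by simp
    qed
    have "ennreal (V y - V x) \<le> emeasure \<nu> {x..y}" by (intro V_diff_le_\<nu>_Icc xyI xy)
    also have "\<dots> = emeasure \<nu> ({x..y} \<inter> E \<union> ({x..y} - E))"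
      by (intro arg_cong[where f="emeasure \<nu>"]) auto
    also have "\<dots> \<le> emeasure \<nu> ({x..y} \<inter> E) + emeasure \<nu> ({x..y} - E)"
      using E xyS by (intro emeasure_subadditive) auto
    also have "\<dots> \<le> ennreal (q * (y - x)) + ennreal (measure \<nu> (T - E))"
    proof (rule add_mono)
      have "emeasure \<nu>_sing ({x..y} \<inter> E) \<le> emeasure \<nu>_sing (I - sing_set)"
        using sing_set(1) by (intro emeasure_mono) (auto simp: E_def sets_sing sets_borel_on_iff)
      then have "emeasure \<nu> ({x..y} \<inter> E) = emeasure \<nu>_ac ({x..y} \<inter> E)"
        using \<nu>_split[of "{x..y} \<inter> E"] E xyS sing_set(3) by simp
      also have "\<dots> \<le> ennreal q * emeasure lborel ({x..y} \<inter> E)"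
        using E xyS by (intro \<nu>_ac_le) (auto simp: E_def)
      also have "\<dots> \<le> ennreal q * emeasure lborel {x..y}"
        using xyS by (intro mult_left_mono emeasure_mono) auto
      also have "\<dots> = ennreal (q * (y - x))" using xy \<open>0 \<le> q\<close> by (simp add: ennreal_mult')
      finally show "emeasure \<nu> ({x..y} \<inter> E) \<le> ennreal (q * (y - x))" .
      have "emeasure \<nu> ({x..y} - E) \<le> emeasure \<nu> (T - E)"
        using xy TS E by (intro emeasure_mono) auto
      also have "\<dots> = ennreal (measure \<nu> (T - E))"
        using fin by (intro emeasure_eq_ennreal_measure) auto
      finally show "emeasure \<nu> ({x..y} - E) \<le> ennreal (measure \<nu> (T - E))" .
    qed
    also have "\<dots> = ennreal (q * (y - x) + measure \<nu> (T - E))"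
      using xy \<open>0 \<le> q\<close> by (intro ennreal_plus[symmetric]) auto
    finally show ?thesis
      using xy \<open>0 \<le> q\<close> by (subst (asm) ennreal_le_iff) (auto simp: add_increasing)
  qed
  have "AE t in lborel. t \<in> E \<longrightarrow> a < t \<and> t < b \<longrightarrow>
    (\<exists>\<delta>>0. \<forall>r. 0 < r \<and> r < \<delta> \<longrightarrow> {t - r..t + r} \<subseteq> {a..b} \<and> measure \<nu> ({t - r..t + r} - E) \<le> \<eta> * r)"
    using E \<nu>_Icc_finite[OF ab] \<open>0 < \<eta>\<close> by (intro AE_restricted_complement[OF ab]) (auto simp: sets_borel_on_iff)
  moreover have "AE t in lborel. t \<notin> sing_set"
    using sing_set by (intro AE_not_in null_setsI) (auto simp: sets_borel_on_iff)
  ultimately show ?thesis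
  proof eventually_elim
    case (elim t)
    show ?case
    proof (intro impI)
      assume t: "a < t \<and> t < b" "f t \<le> ennreal q"
      then have "t \<in> E" using elim sub by (auto simp: E_def)
      with elim t obtain \<delta> where \<delta>: "\<delta> > 0" "\<And>r. 0 < r \<Longrightarrow> r < \<delta> \<Longrightarrow>
          {t - r..t + r} \<subseteq> {a..b} \<and> measure \<nu> ({t - r..t + r} - E) \<le> \<eta> * r" by blast
      show "\<exists>\<delta>>0. \<forall>r. 0 < r \<and> r < \<delta> \<longrightarrow> {t - r..t + r} \<subseteq> I \<and>
          V (t + r) - V t \<le> (q + \<eta>) * r \<and> V t - V (t - r) \<le> (q + \<eta>) * r"
      proof (intro exI[of _ \<delta>] conjI allI impI)
        fix r assume r: "0 < r \<and> r < \<delta>"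
        from \<delta>(2)[of r] r have T: "{t - r..t + r} \<subseteq> {a..b}" "measure \<nu> ({t - r..t + r} - E) \<le> \<eta> * r" by auto
        show "{t - r..t + r} \<subseteq> I" using T sub by blast
        show "V (t + r) - V t \<le> (q + \<eta>) * r" "V t - V (t - r) \<le> (q + \<eta>) * r"
          using *[OF _ _ T(1), of t "t + r"] *[OF _ _ T(1), of "t - r" t] T(2) r by (auto simp: algebra_simps)
      qed (use \<delta> in auto)
    qed
  qed
qed

text \<open>Here the error is Lebesgue measure off \<open>E\<close>, weighted by \<open>q\<close>.
  The singular part can only increase the increment of \<open>V\<close>, so \<open>E\<close> keeps
  the singular set.\<close>

lemma AE_lower_density:
  assumes ab: "a \<in> I" "b \<in> I" and "0 \<le> q" "0 < \<eta>"
  shows "AE t in lborel. a < t \<and> t < b \<longrightarrow> ennreal q \<le> f t \<longrightarrow>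
    (\<exists>\<delta>>0. \<forall>r. 0 < r \<and> r < \<delta> \<longrightarrow>
      (q - \<eta>) * r \<le> V (t + r) - V t \<and> (q - \<eta>) * r \<le> V t - V (t - r))"
proof -
  \<comment> \<open>The error enters with factor \<open>q\<close>, and this choice gives
    \<open>q * \<alpha> \<le> \<eta>\<close>; the added 1 covers \<open>q = 0\<close>.\<close>
  define \<alpha> where "\<alpha> = \<eta> / (q + 1)"
  have \<alpha>: "\<alpha> > 0" "q * \<alpha> \<le> \<eta>" using assms(3,4) by (auto simp: \<alpha>_def field_simps)
  define E where "E = {t \<in> I. ennreal q \<le> f t}"
  have E: "E \<in> sets (borel_on I)" unfolding E_def by (rule level_sets)
  have sub: "{a..b} \<subseteq> I" using between[OF ab] by auto
  have *: "q * (y - x) \<le> V y - V x + q * measure (lborel_on I) (T - E)"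
    if xy: "x \<le> y" "{x..y} \<subseteq> T" and T: "T \<subseteq> {a..b}" "T \<in> sets borel" for x y T
  proof -
    have "x \<in> {x..y}" "y \<in> {x..y}" using xy(1) by auto
    then have xyI: "x \<in> I" "y \<in> I" using xy(2) T(1) sub by blast+
    have xyS: "{x<..<y} \<in> sets (borel_on I)" and TS: "T \<in> sets (borel_on I)" 
      using order_trans[OF xy(2) order_trans[OF T(1) sub]] order_trans[OF T(1) sub] T(2)
      by (auto simp: sets_borel_on_iff)
    have TE: "emeasure lborel (T - E) = ennreal (measure (lborel_on I) (T - E))"
    proof -
      have "emeasure lborel (T - E) \<le> emeasure lborel {a..b}"
        using T by (intro emeasure_mono) auto
      also have "\<dots> < \<infinity>" by (simp add: emeasure_lborel_Icc_eq)
      finally have "emeasure (lborel_on I) (T - E) < \<infinity>" using TS by (subst emeasure_lborel_on) (auto simp: sets_borel_on_iff)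
      moreover have "T - E \<subseteq> I" using TS by (auto simp: sets_borel_on_iff)
      ultimately show ?thesis
        using emeasure_eq_ennreal_measure[of "lborel_on I" "T - E"] by (simp add: emeasure_lborel_on)
    qed
    have "ennreal (q * (y - x)) = ennreal q * emeasure lborel {x<..<y}"
      using xy \<open>0 \<le> q\<close> by (simp add: ennreal_mult')
    also have "\<dots> = ennreal q * emeasure lborel ({x<..<y} \<inter> E \<union> ({x<..<y} - E))"
      by (intro arg_cong[where f="\<lambda>A. ennreal q * emeasure lborel A"]) auto
    also have "\<dots> \<le> ennreal q * (emeasure lborel ({x<..<y} \<inter> E) + emeasure lborel ({x<..<y} - E))"
      using E by (intro mult_left_mono emeasure_subadditive) (auto simp: sets_borel_on_iff)
    also have "\<dots> = ennreal q * emeasure lborel ({x<..<y} \<inter> E) + ennreal q * emeasure lborel ({x<..<y} - E)"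
      by (rule distrib_left)
    also have "\<dots> \<le> ennreal (V y - V x) + ennreal (q * measure (lborel_on I) (T - E))"
    proof (rule add_mono)
      have "ennreal q * emeasure lborel ({x<..<y} \<inter> E) \<le> emeasure \<nu>_ac ({x<..<y} \<inter> E)"
        using E xyS by (intro \<nu>_ac_ge) (auto simp: E_def)
      also have "\<dots> \<le> emeasure \<nu> ({x<..<y} \<inter> E)"
        using \<nu>_split[of "{x<..<y} \<inter> E"] E xyS by (simp add: sets.Int)
      also have "\<dots> \<le> emeasure \<nu> {x<..<y}"
        using xyS by (intro emeasure_mono) auto
      also have "\<dots> \<le> ennreal (V y - V x)" by (intro \<nu>_Ioo_le_V_diff xyI xy)
      finally show "ennreal q * emeasure lborel ({x<..<y} \<inter> E) \<le> ennreal (V y - V x)" .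
      have "{x<..<y} \<subseteq> T" using xy(2) by force
      then have "ennreal q * emeasure lborel ({x<..<y} - E) \<le> ennreal q * emeasure lborel (T - E)"
        using T E by (intro mult_left_mono emeasure_mono) (auto simp: sets_borel_on_iff)
      also have "\<dots> = ennreal (q * measure (lborel_on I) (T - E))"
        using \<open>0 \<le> q\<close> by (simp add: TE ennreal_mult')
      finally show "ennreal q * emeasure lborel ({x<..<y} - E) \<le> ennreal (q * measure (lborel_on I) (T - E))" .
    qed
    also have "\<dots> = ennreal (V y - V x + q * measure (lborel_on I) (T - E))"
      using V_le[OF xyI] xy \<open>0 \<le> q\<close> by (intro ennreal_plus[symmetric]) auto
    finally show ?thesis
      using V_le[OF xyI] xy \<open>0 \<le> q\<close> by (subst (asm) ennreal_le_iff) auto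
  qed
  have "emeasure (lborel_on I) {a..b} < \<infinity>"
    using sub by (simp add: emeasure_lborel_on emeasure_lborel_Icc_eq)
  then have "AE t in lborel. t \<in> E \<longrightarrow> a < t \<and> t < b \<longrightarrow>
    (\<exists>\<delta>>0. \<forall>r. 0 < r \<and> r < \<delta> \<longrightarrow> {t - r..t + r} \<subseteq> {a..b} \<and> measure (lborel_on I) ({t - r..t + r} - E) \<le> \<alpha> * r)"
    using E \<alpha>(1) by (intro AE_restricted_complement[OF ab]) (auto simp: sets_borel_on_iff sets_lborel_on)
  then show ?thesis
  proof eventually_elim
    case (elim t)
    show ?case
    proof (intro impI)
      assume t: "a < t \<and> t < b" "ennreal q \<le> f t"
      then have "t \<in> E" using sub by (auto simp: E_def)
      with elim t obtain \<delta> where \<delta>: "\<delta> > 0" "\<And>r. 0 < r \<Longrightarrow> r < \<delta> \<Longrightarrow>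
          {t - r..t + r} \<subseteq> {a..b} \<and> measure (lborel_on I) ({t - r..t + r} - E) \<le> \<alpha> * r" by blast
      show "\<exists>\<delta>>0. \<forall>r. 0 < r \<and> r < \<delta> \<longrightarrow>
          (q - \<eta>) * r \<le> V (t + r) - V t \<and> (q - \<eta>) * r \<le> V t - V (t - r)"
      proof (intro exI[of _ \<delta>] conjI allI impI)
        fix r assume r: "0 < r \<and> r < \<delta>"
        from \<delta>(2)[of r] r have T: "{t - r..t + r} \<subseteq> {a..b}" "measure (lborel_on I) ({t - r..t + r} - E) \<le> \<alpha> * r" by auto
        have "q * measure (lborel_on I) ({t - r..t + r} - E) \<le> q * \<alpha> * r"
          using T(2) \<open>0 \<le> q\<close> by (simp add: mult.assoc mult_left_mono)
        also have "\<dots> \<le> \<eta> * r" using \<alpha>(2) r by (intro mult_right_mono) auto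
        finally show "(q - \<eta>) * r \<le> V (t + r) - V t" "(q - \<eta>) * r \<le> V t - V (t - r)"
          using *[OF _ _ T(1), of t "t + r"] *[OF _ _ T(1), of "t - r" t] r by (auto simp: algebra_simps)
      qed (use \<delta> in auto)
    qed
  qed
qed

lemma AE_f_finite:
  assumes ab: "a \<in> I" "b \<in> I"
  shows "AE t in lborel. a < t \<and> t < b \<longrightarrow> f t < \<infinity>"
proof -
  have S: "{a..b} \<in> sets (borel_on I)" using between[OF ab] by (auto simp: sets_borel_on_iff)
  have "(\<integral>\<^sup>+t. f t * indicator {a..b} t \<partial>lborel_on I) = emeasure \<nu>_ac {a..b}"
    using \<nu>_ac_eq[OF S] by simp
  also have "\<dots> \<le> emeasure \<nu> {a..b}" using \<nu>_split[OF S] by simp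
  also have "\<dots> < \<infinity>" by (rule \<nu>_Icc_finite[OF ab])
  finally have "AE t in lborel_on I. f t * indicator {a..b} t \<noteq> \<infinity>"
    using S by (intro nn_integral_PInf_AE) (auto simp: sets_lborel_on)
  then have "AE t in lborel. t \<in> I \<longrightarrow> f t * indicator {a..b} t \<noteq> \<infinity>"
    by (subst (asm) AE_restrict_space_iff) auto
  then show ?thesis
  proof eventually_elim
    case (elim t)
    then show ?case using between[OF ab, of t] by (auto simp: top.not_eq_extremum)
  qed
qed

end

section \<open>The metric derivative\<close>

lemma has_metric_derivative_iff:
  "has_metric_derivative I \<gamma> t m \<longleftrightarrow> ((\<lambda>s. dist (\<gamma> s) (\<gamma> t) / \<bar>s - t\<bar>) \<longlongrightarrow> m) (at t within I)"
proof -
  have ball: "(\<forall>x\<in>{\<epsilon>. t + \<epsilon> \<in> I}. Q x) \<longleftrightarrow> (\<forall>s\<in>I. Q (s - t))" for Q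
  proof
    assume *: "\<forall>x\<in>{\<epsilon>. t + \<epsilon> \<in> I}. Q x"
    show "\<forall>s\<in>I. Q (s - t)" using * by simp
  next
    assume *: "\<forall>s\<in>I. Q (s - t)"
    show "\<forall>x\<in>{\<epsilon>. t + \<epsilon> \<in> I}. Q x" using * by force
  qed
  show ?thesis
    unfolding has_metric_derivative_def Lim_within ball by (simp add: dist_real_def)
qed

text \<open>Along a trivial filter every number is a limit, so the description determines a value
  only if \<open>t\<close> is not isolated in \<open>I\<close>.\<close>

lemma metric_derivative_eqI:
  assumes "has_metric_derivative I \<gamma> t m" "at t within I \<noteq> bot"
  shows "metric_derivative I \<gamma> t = m"
proof -
  have unique: "m' = m" if "has_metric_derivative I \<gamma> t m'" for m'
    using tendsto_unique[OF assms(2) that[unfolded has_metric_derivative_iff] assms(1)[unfolded has_metric_derivative_iff]] .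
  have "(THE m. has_metric_derivative I \<gamma> t m) = m"
    by (rule the_equality[where P="has_metric_derivative I \<gamma> t", OF assms(1) unique])
  then show ?thesis using assms(1) by (auto simp: metric_derivative_def)
qed

context bv_decomposition
begin

text \<open>With \<open>m\<close> the value of the density, rationals \<open>p\<close> and
  \<open>q\<close> close to \<open>m\<close> enclose the difference quotients of \<open>V\<close>,
  and a chord loses at most \<open>\<eta> * r\<close>. The quotient then lies between
  \<open>p - 2 * \<eta>\<close> and \<open>q + \<eta>\<close>, within \<open>e\<close> of
  \<open>m\<close> as all tolerances are below \<open>e / 4\<close>.\<close>

lemma metric_derivative_at_good_point:
  assumes t: "t \<in> I" and fin: "f t < \<infinity>"
    and upper: "\<And>q \<eta>. q \<in> \<rat> \<Longrightarrow> \<eta> \<in> \<rat> \<Longrightarrow> 0 \<le> q \<Longrightarrow> 0 < \<eta> \<Longrightarrow> f t \<le> ennreal q \<Longrightarrow>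
      \<exists>\<delta>>0. \<forall>r. 0 < r \<and> r < \<delta> \<longrightarrow> {t - r..t + r} \<subseteq> I \<and>
        V (t + r) - V t \<le> (q + \<eta>) * r \<and> V t - V (t - r) \<le> (q + \<eta>) * r"
    and lower: "\<And>q \<eta>. q \<in> \<rat> \<Longrightarrow> \<eta> \<in> \<rat> \<Longrightarrow> 0 \<le> q \<Longrightarrow> 0 < \<eta> \<Longrightarrow> ennreal q \<le> f t \<Longrightarrow>
      \<exists>\<delta>>0. \<forall>r. 0 < r \<and> r < \<delta> \<longrightarrow>
        (q - \<eta>) * r \<le> V (t + r) - V t \<and> (q - \<eta>) * r \<le> V t - V (t - r)"
    and chord: "\<And>\<eta>. \<eta> \<in> \<rat> \<Longrightarrow> 0 < \<eta> \<Longrightarrow> \<exists>\<delta>>0. \<forall>r. 0 < r \<and> r < \<delta> \<longrightarrow>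
        V (t + r) - V t - dist (\<gamma> t) (\<gamma> (t + r)) \<le> \<eta> * r \<and>
        V t - V (t - r) - dist (\<gamma> (t - r)) (\<gamma> t) \<le> \<eta> * r"
  shows "has_metric_derivative I \<gamma> t (enn2real (f t))"
  unfolding has_metric_derivative_iff Lim_within
proof (intro allI impI)
  fix e :: real assume e: "0 < e"
  define m where "m = enn2real (f t)"
  have m: "0 \<le> m" "f t = ennreal m" using fin by (auto simp: m_def)
  obtain \<eta> where \<eta>: "\<eta> \<in> \<rat>" "0 < \<eta>" "\<eta> < e / 4" using Rats_dense_in_real[of 0 "e / 4"] e by auto
  obtain q where q: "q \<in> \<rat>" "m < q" "q < m + e / 4" using Rats_dense_in_real[of m "m + e / 4"] e by auto
  have "f t \<le> ennreal q" "0 \<le> q" using m q by (auto intro: ennreal_leI)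
  from upper[OF q(1) \<eta>(1) this(2) \<eta>(2) this(1)] obtain \<delta>1 where \<delta>1: "\<delta>1 > 0" "\<And>r. 0 < r \<Longrightarrow> r < \<delta>1 \<Longrightarrow> {t - r..t + r} \<subseteq> I \<and>
        V (t + r) - V t \<le> (q + \<eta>) * r \<and> V t - V (t - r) \<le> (q + \<eta>) * r"
    by blast
  obtain \<delta>2 where \<delta>2: "\<delta>2 > 0" "\<And>r. 0 < r \<Longrightarrow> r < \<delta>2 \<Longrightarrow>
        V (t + r) - V t - dist (\<gamma> t) (\<gamma> (t + r)) \<le> \<eta> * r \<and>
        V t - V (t - r) - dist (\<gamma> (t - r)) (\<gamma> t) \<le> \<eta> * r"
    using chord[OF \<eta>(1,2)] by blast
  have "\<exists>p \<delta>. m - e / 4 < p \<and> \<delta> > 0 \<and> (\<forall>r. 0 < r \<and> r < \<delta> \<longrightarrow>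
        (p - \<eta>) * r \<le> V (t + r) - V t \<and> (p - \<eta>) * r \<le> V t - V (t - r))"
  \<comment> \<open>For \<open>m = 0\<close> there is no \<open>p\<close> with
    \<open>0 \<le> p < m\<close>; then \<open>p = 0\<close> serves and monotonicity of
    \<open>V\<close> is the lower bound. The inclusion in \<open>upper\<close> puts
    \<open>t - r\<close> and \<open>t + r\<close> in \<open>I\<close>.\<close>
  proof (cases "m = 0")
    case True
    show ?thesis
    proof (rule exI[of _ 0], rule exI[of _ \<delta>1], intro conjI allI impI)
      fix r assume r: "0 < r \<and> r < \<delta>1"
      then have "t - r \<in> {t - r..t + r}" "t + r \<in> {t - r..t + r}" by auto
      then have "t - r \<in> I" "t + r \<in> I" using \<delta>1(2)[of r] r by blast+
      then have "V t \<le> V (t + r)" "V (t - r) \<le> V t" using r t by (auto intro!: V_le)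
      moreover have "(0 - \<eta>) * r \<le> 0" using r \<eta> by simp
      ultimately show "(0 - \<eta>) * r \<le> V (t + r) - V t" "(0 - \<eta>) * r \<le> V t - V (t - r)" by linarith+
    qed (use True e \<delta>1 in auto)
  next
    case False
    then obtain p where p: "p \<in> \<rat>" "max 0 (m - e / 4) < p" "p < m"
      using Rats_dense_in_real[of "max 0 (m - e / 4)" m] e m(1) by auto
    then have "ennreal p \<le> f t" "0 \<le> p" "m - e / 4 < p" using m by (auto intro: ennreal_leI)
    then show ?thesis using lower[OF p(1) \<eta>(1) _ \<eta>(2)] by blast
  qed
  then obtain p \<delta>3 where p: "m - e / 4 < p" and \<delta>3: "\<delta>3 > 0" "\<And>r. 0 < r \<Longrightarrow> r < \<delta>3 \<Longrightarrow>
        (p - \<eta>) * r \<le> V (t + r) - V t \<and> (p - \<eta>) * r \<le> V t - V (t - r)"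
    by blast
  show "\<exists>d>0. \<forall>s\<in>I. 0 < dist s t \<and> dist s t < d \<longrightarrow>
      dist (dist (\<gamma> s) (\<gamma> t) / \<bar>s - t\<bar>) (enn2real (f t)) < e"
  proof (intro exI[of _ "min \<delta>1 (min \<delta>2 \<delta>3)"] conjI ballI impI)
    fix s assume s: "s \<in> I" "0 < dist s t \<and> dist s t < min \<delta>1 (min \<delta>2 \<delta>3)"
    define r where "r = \<bar>s - t\<bar>"
    have r: "0 < r" "r < \<delta>1" "r < \<delta>2" "r < \<delta>3" using s by (auto simp: r_def dist_real_def)
    have "dist (\<gamma> s) (\<gamma> t) \<le> (q + \<eta>) * r \<and> (p - 2 * \<eta>) * r \<le> dist (\<gamma> s) (\<gamma> t)"
    proof (cases "t < s")
      case True
      then have "s = t + r" by (simp add: r_def)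
      then show ?thesis
        using \<delta>1(2)[OF r(1,2)] \<delta>2(2)[OF r(1,3)] \<delta>3(2)[OF r(1,4)] dist_le_V[OF t s(1)] True
        by (simp add: dist_commute algebra_simps)
    next
      case False
      then have s_eq: "s = t - r" by (simp add: r_def)
      have "dist (\<gamma> s) (\<gamma> t) \<le> V t - V s" using dist_le_V[OF s(1) t] False by simp
      then show ?thesis
        using \<delta>1(2)[OF r(1,2)] \<delta>2(2)[OF r(1,3)] \<delta>3(2)[OF r(1,4)]
        unfolding s_eq by (simp add: algebra_simps)
    qed
    then have "dist (\<gamma> s) (\<gamma> t) / r \<le> q + \<eta>" "p - 2 * \<eta> \<le> dist (\<gamma> s) (\<gamma> t) / r"
      using r(1) by (auto simp: pos_divide_le_eq pos_le_divide_eq)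
    then have "\<bar>dist (\<gamma> s) (\<gamma> t) / r - m\<bar> < e" using q p \<eta> by linarith
    then show "dist (dist (\<gamma> s) (\<gamma> t) / \<bar>s - t\<bar>) (enn2real (f t)) < e"
      by (simp add: dist_real_def r_def m_def)
  qed (use \<delta>1 \<delta>2 \<delta>3 in auto)
qed

text \<open>For a fixed window, countably many rational \<open>q\<close> and \<open>\<eta>\<close>
  give one null set, and countably many windows with rational endpoints reach every point of
  \<open>I\<close> except its minimum and maximum.\<close>

lemma AE_has_metric_derivative:
  "AE t in lborel. t \<in> I \<longrightarrow> f t < \<infinity> \<and> at t within I \<noteq> bot \<and> has_metric_derivative I \<gamma> t (enn2real (f t))"
proof -
  have local: "AE t in lborel. a < t \<and> t < b \<longrightarrow> f t < \<infinity> \<and> has_metric_derivative I \<gamma> t (enn2real (f t))"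
    if ab: "a \<in> I" "b \<in> I" for a b
  proof -
    define P where "P t q \<eta> \<longleftrightarrow> (0 \<le> q \<longrightarrow> 0 < \<eta> \<longrightarrow> a < t \<and> t < b \<longrightarrow> f t \<le> ennreal q \<longrightarrow>
    (\<exists>\<delta>>0. \<forall>r. 0 < r \<and> r < \<delta> \<longrightarrow> {t - r..t + r} \<subseteq> I \<and>
      V (t + r) - V t \<le> (q + \<eta>) * r \<and> V t - V (t - r) \<le> (q + \<eta>) * r))" for t q \<eta>
    define Q where "Q t q \<eta> \<longleftrightarrow> (0 \<le> q \<longrightarrow> 0 < \<eta> \<longrightarrow> a < t \<and> t < b \<longrightarrow> ennreal q \<le> f t \<longrightarrow>
    (\<exists>\<delta>>0. \<forall>r. 0 < r \<and> r < \<delta> \<longrightarrow>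
      (q - \<eta>) * r \<le> V (t + r) - V t \<and> (q - \<eta>) * r \<le> V t - V (t - r)))" for t q \<eta>
    define R where "R t \<eta> \<longleftrightarrow> (0 < \<eta> \<longrightarrow> a < t \<and> t < b \<longrightarrow> (\<exists>\<delta>>0. \<forall>r. 0 < r \<and> r < \<delta> \<longrightarrow>
    V (t + r) - V t - dist (\<gamma> t) (\<gamma> (t + r)) \<le> \<eta> * r \<and>
    V t - V (t - r) - dist (\<gamma> (t - r)) (\<gamma> t) \<le> \<eta> * r))" for t \<eta>
    have "AE t in lborel. \<forall>q\<in>\<rat>. \<forall>\<eta>\<in>\<rat>. P t q \<eta>"
    proof (intro AE_ball_countable' countable_rat)
      fix q \<eta> :: real
      show "AE t in lborel. P t q \<eta>"
        unfolding P_def using AE_upper_density[OF ab, of q \<eta>] by (cases "0 \<le> q \<and> 0 < \<eta>") auto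
    qed
    moreover have "AE t in lborel. \<forall>q\<in>\<rat>. \<forall>\<eta>\<in>\<rat>. Q t q \<eta>"
    proof (intro AE_ball_countable' countable_rat)
      fix q \<eta> :: real
      show "AE t in lborel. Q t q \<eta>"
        unfolding Q_def using AE_lower_density[OF ab, of q \<eta>] by (cases "0 \<le> q \<and> 0 < \<eta>") auto
    qed
    moreover have "AE t in lborel. \<forall>\<eta>\<in>\<rat>. R t \<eta>"
    proof (intro AE_ball_countable' countable_rat)
      fix \<eta> :: real
      show "AE t in lborel. R t \<eta>"
      proof (cases "a < b \<and> 0 < \<eta>")
        case True
        then show ?thesis using AE_variation_minus_chord[OF ab, of \<eta>] unfolding R_def by auto
      qed (auto simp: R_def)
    qed
    ultimately show ?thesis using AE_f_finite[OF ab]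
    proof eventually_elim
      case (elim t)
      show ?case
      proof (intro impI conjI)
        assume t: "a < t \<and> t < b"
        then show fin: "f t < \<infinity>" using elim(4) by blast
        show "has_metric_derivative I \<gamma> t (enn2real (f t))"
        proof (rule metric_derivative_at_good_point[OF _ fin])
          show "t \<in> I" using between[OF ab, of t] t by simp
        next
          fix q \<eta> :: real assume "q \<in> \<rat>" "\<eta> \<in> \<rat>" "0 \<le> q" "0 < \<eta>" "f t \<le> ennreal q"
          then show "\<exists>\<delta>>0. \<forall>r. 0 < r \<and> r < \<delta> \<longrightarrow> {t - r..t + r} \<subseteq> I \<and>
              V (t + r) - V t \<le> (q + \<eta>) * r \<and> V t - V (t - r) \<le> (q + \<eta>) * r"
            using elim(1) t unfolding P_def by blast
        next
          fix q \<eta> :: real assume "q \<in> \<rat>" "\<eta> \<in> \<rat>" "0 \<le> q" "0 < \<eta>" "ennreal q \<le> f t"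
          then show "\<exists>\<delta>>0. \<forall>r. 0 < r \<and> r < \<delta> \<longrightarrow>
              (q - \<eta>) * r \<le> V (t + r) - V t \<and> (q - \<eta>) * r \<le> V t - V (t - r)"
            using elim(2) t unfolding Q_def by blast
        next
          fix \<eta> :: real assume "\<eta> \<in> \<rat>" "0 < \<eta>"
          then show "\<exists>\<delta>>0. \<forall>r. 0 < r \<and> r < \<delta> \<longrightarrow>
              V (t + r) - V t - dist (\<gamma> t) (\<gamma> (t + r)) \<le> \<eta> * r \<and>
              V t - V (t - r) - dist (\<gamma> (t - r)) (\<gamma> t) \<le> \<eta> * r"
            using elim(3) t unfolding R_def by blast
        qed
      qed
    qed
  qed
  have "AE t in lborel. \<forall>a\<in>\<rat>. \<forall>b\<in>\<rat>. a \<in> I \<longrightarrow> b \<in> I \<longrightarrow> a < t \<and> t < b \<longrightarrow> f t < \<infinity> \<and> has_metric_derivative I \<gamma> t (enn2real (f t))"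
  proof (intro AE_ball_countable' countable_rat)
    fix a b :: real
    show "AE t in lborel. a \<in> I \<longrightarrow> b \<in> I \<longrightarrow> a < t \<and> t < b \<longrightarrow> f t < \<infinity> \<and> has_metric_derivative I \<gamma> t (enn2real (f t))"
      using local[of a b] by (cases "a \<in> I \<and> b \<in> I") auto
  qed
  moreover
  let ?E = "{x\<in>I. \<forall>y\<in>I. x \<le> y} \<union> {x\<in>I. \<forall>y\<in>I. y \<le> x}"
  have "finite ?E" by (intro finite_UnI finite_if_unique) (auto intro: order_antisym)
  then have "AE t in lborel. t \<notin> ?E" by (intro AE_not_in finite_imp_null_set_lborel)
  ultimately show ?thesis
  proof eventually_elim
    case (elim t)
    show ?case
    proof
      assume t: "t \<in> I"
      with elim(2) obtain l u where lu: "l \<in> I" "u \<in> I" "l < t" "t < u" by (auto simp: not_le)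
      obtain a where a: "a \<in> \<rat>" "l < a" "a < t" using Rats_dense_in_real[OF lu(3)] by auto
      obtain b where b: "b \<in> \<rat>" "t < b" "b < u" using Rats_dense_in_real[OF lu(4)] by auto
      have "a \<in> I" "b \<in> I" 
        using between[OF lu(1,2), of a] between[OF lu(1,2), of b] a b lu by linarith+
      then have 1: "f t < \<infinity> \<and> has_metric_derivative I \<gamma> t (enn2real (f t))"
        using elim(1) a b by blast
      have sub: "{l<..<u} \<subseteq> I" using between[OF lu(1,2)] by auto
      have int: "t \<in> interior I" using lu(3,4) by (intro interiorI[OF open_greaterThanLessThan _ sub]) simp
      have "at t within I \<noteq> bot" unfolding at_within_interior[OF int] by (rule at_neq_bot)
      with 1 show "f t < \<infinity> \<and> at t within I \<noteq> bot \<and> has_metric_derivative I \<gamma> t (enn2real (f t))" by blast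
    qed
  qed
qed

lemma AE_metric_derivative_eq_f: "AE t in lborel_on I. ennreal (metric_derivative I \<gamma> t) = f t"
proof -
  have "AE t in lborel. t \<in> I \<longrightarrow> ennreal (metric_derivative I \<gamma> t) = f t"
    using AE_has_metric_derivative
  proof eventually_elim
    case (elim t)
    then show ?case using metric_derivative_eqI[of I \<gamma> t "enn2real (f t)"] by auto
  qed
  then show ?thesis by (subst AE_restrict_space_iff) auto
qed

end

text \<open>A supremum over an uncountable punctured ball does not change when restricted to
  \<open>Q\<close>: the value at a remaining point \<open>y\<close> is a limit of values at points
  of \<open>Q\<close> tending to \<open>y\<close>. The upper limit becomes an infimum of countable
  suprema.\<close>

lemma measurable_Limsup_within:
  fixes \<phi> :: "real \<Rightarrow> real \<Rightarrow> ereal"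
  assumes Q: "countable Q" "Q \<subseteq> I"
    and meas: "\<And>q. q \<in> Q \<Longrightarrow> \<phi> q \<in> borel_measurable (borel_on I)"
    and lim: "\<And>t y. t \<in> I \<Longrightarrow> y \<in> I - Q \<Longrightarrow> y \<noteq> t \<Longrightarrow> ((\<lambda>s. \<phi> s t) \<longlongrightarrow> \<phi> y t) (at y within Q)"
    and dense: "\<And>y. y \<in> I - Q \<Longrightarrow> at y within Q \<noteq> bot"
  shows "(\<lambda>t. Limsup (at t within I) (\<lambda>s. \<phi> s t)) \<in> borel_measurable (borel_on I)"
proof -
  \<comment> \<open>The neutral value \<open>bot\<close> lets the index set of the supremum stay
    \<open>Q\<close>, independent of \<open>t\<close>, although only points of the punctured ball
    count.\<close>
  define g where "g n q t = (if 0 < \<bar>q - t\<bar> \<and> \<bar>q - t\<bar> < 1 / real (Suc n) then \<phi> q t else bot)" for n q t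
  have id [measurable]: "(\<lambda>t. t) \<in> borel_measurable (borel_on I)"
    by (intro measurable_restrict_space1) simp
  have g [measurable]: "g n q \<in> borel_measurable (borel_on I)" if "q \<in> Q" for n q
    unfolding g_def using meas[OF that] by measurable
  have "Limsup (at t within I) (\<lambda>s. \<phi> s t) = (INF n. SUP q\<in>Q. g n q t)" if t: "t \<in> I" for t
  proof (rule antisym)
    show "Limsup (at t within I) (\<lambda>s. \<phi> s t) \<le> (INF n. SUP q\<in>Q. g n q t)"
    proof (rule INF_greatest)
      fix n
      let ?e = "1 / real (Suc n)"
      have "\<phi> y t \<le> (SUP q\<in>Q. g n q t)" if y: "y \<in> I \<inter> ball t ?e - {t}" for y
      proof (cases "y \<in> Q")
        case True
        then show ?thesis using y by (intro SUP_upper2[of y]) (auto simp: g_def dist_real_def)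
      next
        case False
        have "\<forall>\<^sub>F q in at y within Q. q \<in> ball t ?e - {t}"
          using y by (intro eventually_at_in_open'[THEN filter_leD[OF at_le[OF subset_UNIV]]]) auto
        moreover have "\<forall>\<^sub>F q in at y within Q. q \<in> Q"
          by (simp add: eventually_at_filter)
        ultimately have "\<forall>\<^sub>F q in at y within Q. \<phi> q t \<le> (SUP q\<in>Q. g n q t)"
        proof eventually_elim
          case (elim q)
          then show ?case by (intro SUP_upper2[of q]) (auto simp: g_def dist_real_def)
        qed
        then show ?thesis
          using lim[OF t] dense y False by (intro tendsto_upperbound) auto
      qed
      then have "(SUP y\<in>I \<inter> ball t ?e - {t}. \<phi> y t) \<le> (SUP q\<in>Q. g n q t)"
        by (rule SUP_least)
      then show "Limsup (at t within I) (\<lambda>s. \<phi> s t) \<le> (SUP q\<in>Q. g n q t)"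
        unfolding Limsup_within by (intro INF_lower2[of ?e]) auto
    qed
    show "(INF n. SUP q\<in>Q. g n q t) \<le> Limsup (at t within I) (\<lambda>s. \<phi> s t)"
      unfolding Limsup_within
    proof (rule INF_greatest)
      fix e :: real assume "e \<in> {0<..}"
      then obtain n where n: "1 / real (Suc n) < e" using nat_approx_posE by auto
      have "(SUP q\<in>Q. g n q t) \<le> (SUP y\<in>I \<inter> ball t e - {t}. \<phi> y t)"
      proof (rule SUP_least)
        fix q assume "q \<in> Q"
        then show "g n q t \<le> (SUP y\<in>I \<inter> ball t e - {t}. \<phi> y t)"
          using Q(2) n by (auto simp: g_def dist_real_def intro!: SUP_upper)
      qed
      then show "(INF n. SUP q\<in>Q. g n q t) \<le> (SUP y\<in>I \<inter> ball t e - {t}. \<phi> y t)"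
        by (rule INF_lower2[OF UNIV_I])
    qed
  qed
  moreover have "(\<lambda>t. INF n. SUP q\<in>Q. g n q t) \<in> borel_measurable (borel_on I)"
    using Q(1) by measurable
  ultimately show ?thesis
    by (subst measurable_cong[of _ _ "\<lambda>t. INF n. SUP q\<in>Q. g n q t"]) (auto simp: space_restrict_space)
qed

context bv_path
begin

text \<open>Adding \<open>V\<close> makes the distance nondecreasing, so it is a difference of two
  monotone functions.\<close>

lemma measurable_dist_\<gamma>:
  assumes "q \<in> I"
  shows "(\<lambda>t. dist (\<gamma> q) (\<gamma> t)) \<in> borel_measurable (borel_on I)"
proof -
  have "mono_on I (\<lambda>t. V t + dist (\<gamma> q) (\<gamma> t))"
  proof (rule mono_onI)
    fix s t assume "s \<in> I" "t \<in> I" "s \<le> t"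
    from dist_le_V[OF this] show "V s + dist (\<gamma> q) (\<gamma> s) \<le> V t + dist (\<gamma> q) (\<gamma> t)"
      using dist_triangle[of "\<gamma> q" "\<gamma> s" "\<gamma> t"] by (simp add: dist_commute)
  qed
  then have "(\<lambda>t. (V t + dist (\<gamma> q) (\<gamma> t)) - V t) \<in> borel_measurable (borel_on I)"
    using mono_V by (intro borel_measurable_diff borel_measurable_mono_on_fnc)
  then show ?thesis by simp
qed

lemma measurable_metric_derivative: "metric_derivative I \<gamma> \<in> borel_measurable (borel_on I)"
proof (cases "I = {c}")
  case True
  have "metric_derivative I \<gamma> \<in> borel_measurable (borel_on I) \<longleftrightarrow>
      (\<lambda>t. metric_derivative I \<gamma> c) \<in> borel_measurable (borel_on I)"
    using True by (intro measurable_cong) (simp add: space_restrict_space)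
  then show ?thesis by simp
next
  case False
  \<comment> \<open>At points of \<open>I\<close> outside \<open>Q\<close> the path is continuous,
    so the difference quotient there is a limit along \<open>Q\<close>. Density of \<open>Q\<close>
    needs a second point of \<open>I\<close>, hence the separate one-point case.\<close>
  define Q where "Q = (I \<inter> \<rat>) \<union> discontinuities I \<gamma>"
  have Q: "countable Q" "Q \<subseteq> I"
    using countable_discontinuities by (auto simp: Q_def countable_rat discontinuities_def)
  have dense: "at y within Q \<noteq> bot" if y: "y \<in> I" for y
  proof -
    obtain z where z: "z \<in> I" "z \<noteq> y" using False y c_in by blast
    have "\<exists>x\<in>Q. x \<noteq> y \<and> dist x y < e" if e: "e > 0" for e
    proof (cases "y < z")
      case True
      then obtain q where q: "q \<in> \<rat>" "y < q" "q < min z (y + e)"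
        using Rats_dense_in_real[of y "min z (y + e)"] e by auto
      then have "q \<in> I" using between[OF y z(1), of q] by simp
      then show ?thesis using q by (intro bexI[of _ q]) (auto simp: Q_def dist_real_def)
    next
      case False
      then obtain q where q: "q \<in> \<rat>" "max z (y - e) < q" "q < y"
        using Rats_dense_in_real[of "max z (y - e)" y] e z(2) by auto
      then have "q \<in> I" using between[OF z(1) y, of q] by simp
      then show ?thesis using q by (intro bexI[of _ q]) (auto simp: Q_def dist_real_def)
    qed
    then show ?thesis unfolding trivial_limit_within islimpt_approachable by blast
  qed
  define E where "E s t = dist (\<gamma> s) (\<gamma> t) / \<bar>s - t\<bar>" for s t
  have [measurable]: "E q \<in> borel_measurable (borel_on I)" if "q \<in> Q" for q
  proof -
    have [measurable]: "(\<lambda>t. t) \<in> borel_measurable (borel_on I)"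
      by (intro measurable_restrict_space1) simp
    have [measurable]: "(\<lambda>t. dist (\<gamma> q) (\<gamma> t)) \<in> borel_measurable (borel_on I)"
      using that Q(2) by (intro measurable_dist_\<gamma>) auto
    show ?thesis unfolding E_def by measurable
  qed
  have E_lim: "((\<lambda>s. E s t) \<longlongrightarrow> E y t) (at y within Q)" if "y \<in> I - Q" "y \<noteq> t" for t y
  proof -
    have "(\<gamma> \<longlongrightarrow> \<gamma> y) (at y within I)"
      using that(1) unfolding Q_def discontinuities_def continuous_within by auto
    then have "(\<gamma> \<longlongrightarrow> \<gamma> y) (at y within Q)" by (rule tendsto_within_subset[OF _ Q(2)])
    then show ?thesis unfolding E_def using that(2) by (intro tendsto_intros) auto
  qed
  define Up where "Up t = Limsup (at t within I) (\<lambda>s. ereal (E s t))" for t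
  define Lo where "Lo t = Liminf (at t within I) (\<lambda>s. ereal (E s t))" for t
  have [measurable]: "Up \<in> borel_measurable (borel_on I)"
    unfolding Up_def using Q dense E_lim
    by (intro measurable_Limsup_within[where Q=Q] tendsto_ereal) auto
  have "(\<lambda>t. Limsup (at t within I) (\<lambda>s. - ereal (E s t))) \<in> borel_measurable (borel_on I)"
    using Q dense E_lim
    by (intro measurable_Limsup_within[where Q=Q and \<phi>="\<lambda>s t. - ereal (E s t)"] tendsto_ereal tendsto_uminus_ereal) auto
  then have [measurable]: "Lo \<in> borel_measurable (borel_on I)"
    unfolding Lo_def ereal_Limsup_uminus by simp
  \<comment> \<open>An infinite common limit counts as nonexistence, and the value 0 is the default
    in the definition.\<close>
  have "metric_derivative I \<gamma> t = (if Up t = Lo t \<and> \<bar>Up t\<bar> \<noteq> \<infinity> then real_of_ereal (Up t) else 0)" if t: "t \<in> I" for t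
  proof -
    have nb: "at t within I \<noteq> bot"
      using dense[OF t] at_le[OF Q(2), of t] by (metis bot.extremum_uniqueI)
    have iff: "has_metric_derivative I \<gamma> t m \<longleftrightarrow> Lo t = ereal m \<and> Up t = ereal m" for m
      unfolding has_metric_derivative_iff Lo_def Up_def tendsto_iff_Liminf_eq_Limsup[OF nb, symmetric]
      by (simp add: E_def)
    show ?thesis
    proof (cases "\<exists>m. has_metric_derivative I \<gamma> t m")
      case True
      then obtain m where m: "has_metric_derivative I \<gamma> t m" by blast
      then show ?thesis using metric_derivative_eqI[OF m nb] by (simp add: iff)
    next
      case False
      then have "\<not> (Up t = Lo t \<and> \<bar>Up t\<bar> \<noteq> \<infinity>)" by (cases "Up t") (auto simp: iff)
      then show ?thesis using False by (auto simp: metric_derivative_def)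
    qed
  qed
  moreover have "(\<lambda>t. if Up t = Lo t \<and> \<bar>Up t\<bar> \<noteq> \<infinity> then real_of_ereal (Up t) else 0) \<in> borel_measurable (borel_on I)"
    by measurable
  ultimately show ?thesis
    by (subst measurable_cong[of _ _ "\<lambda>t. if Up t = Lo t \<and> \<bar>Up t\<bar> \<noteq> \<infinity> then real_of_ereal (Up t) else 0"])
      (auto simp: space_restrict_space)
qed

end

section \<open>Identification of the density and the variation formula\<close>

context bv_decomposition
begin

lemma measurable_metric_derivative_lborel [measurable]:
  "metric_derivative I \<gamma> \<in> borel_measurable (lborel_on I)"
  using measurable_metric_derivative by (simp cong: measurable_cong_sets add: sets_lborel_on)

lemma \<nu>_ac_density: "\<nu>_ac = density (lborel_on I) (\<lambda>t. ennreal (metric_derivative I \<gamma> t))"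
proof -
  have "AE t in lborel_on I. f t = ennreal (metric_derivative I \<gamma> t)"
    using AE_metric_derivative_eq_f by eventually_elim simp
  then have "density (lborel_on I) f = density (lborel_on I) (\<lambda>t. ennreal (metric_derivative I \<gamma> t))"
    by (intro density_cong) auto
  then show ?thesis by (simp only: density_f)
qed

lemma \<nu>_eq:
  assumes "connected J" "J \<subseteq> I"
  shows "emeasure \<nu> J = (\<integral>\<^sup>+t\<in>J. ennreal (metric_derivative I \<gamma> t) \<partial>lborel_on I) + emeasure \<nu>_sing J"
proof -
  have J: "J \<in> sets (borel_on I)" using assms borel_connected by (auto simp: sets_borel_on_iff)
  have "emeasure \<nu>_ac J = (\<integral>\<^sup>+t\<in>J. ennreal (metric_derivative I \<gamma> t) \<partial>lborel_on I)"
    unfolding \<nu>_ac_density using J by (intro emeasure_density) (auto simp: sets_lborel_on)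
  then show ?thesis using \<nu>_split[OF J] by simp
qed

lemma AE_metric_derivative_exists: "AE t in lborel_on I. \<exists>m. has_metric_derivative I \<gamma> t m"
proof -
  have "AE t in lborel. t \<in> I \<longrightarrow> (\<exists>m. has_metric_derivative I \<gamma> t m)"
    using AE_has_metric_derivative by eventually_elim blast
  then show ?thesis by (subst AE_restrict_space_iff) auto
qed

end

theorem theorem4p4:
  fixes I :: "real set" and \<gamma> :: "real \<Rightarrow> 'a::metric_space"
    and c :: real and \<nu>_ac \<nu>_sing :: "real measure"
  assumes "connected I" and "c \<in> I"
    and "locally_bounded_variation I \<gamma>"
    and "lebesgue_decomposition (lborel_on I) (speed_measure I c \<gamma>) \<nu>_ac \<nu>_sing"
  shows "(AE t in lborel_on I. \<exists>m. has_metric_derivative I \<gamma> t m)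
    \<and> metric_derivative I \<gamma> \<in> borel_measurable (lborel_on I)
    \<and> \<nu>_ac = density (lborel_on I) (\<lambda>t. ennreal (metric_derivative I \<gamma> t))
    \<and> (\<forall>J. connected J \<and> J \<subseteq> I \<longrightarrow>
          variation \<gamma> J \<le> (\<integral>\<^sup>+t\<in>J. ennreal (metric_derivative I \<gamma> t) \<partial>lborel_on I) + emeasure \<nu>_sing J)
    \<and> (\<forall>J. connected J \<and> J \<subseteq> I \<and> J - interior J \<subseteq> I - discontinuities I \<gamma> \<longrightarrow>
          variation \<gamma> J = (\<integral>\<^sup>+t\<in>J. ennreal (metric_derivative I \<gamma> t) \<partial>lborel_on I) + emeasure \<nu>_sing J)
    \<and> (continuous_on I \<gamma> \<longrightarrow>
        (\<forall>J. connected J \<and> J \<subseteq> I \<longrightarrow>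
          curve_length \<gamma> J = (\<integral>\<^sup>+t\<in>J. ennreal (metric_derivative I \<gamma> t) \<partial>lborel_on I) + emeasure \<nu>_sing J))"
proof -
  interpret bv_decomposition I \<gamma> c \<nu>_ac \<nu>_sing
    using assms by unfold_locales
  have cont: "J - interior J \<subseteq> I - discontinuities I \<gamma>" if "continuous_on I \<gamma>" "J \<subseteq> I" for J
    using that by (auto simp: discontinuities_def continuous_on_eq_continuous_within)
  show ?thesis
    using AE_metric_derivative_exists measurable_metric_derivative_lborel \<nu>_ac_density
      variation_le_\<nu> variation_eq_\<nu> cont
    by (simp add: \<nu>_eq curve_length_def)
qed

end
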